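(* Let $G=(V,E)$ be a directed graph with $n$ nodes, let $t\in V$ be a target node, let $\alpha\in(0,1)$ be a constant teleport probability, and let $\delta\in(0,1)$ be a relative error threshold. Run Randomized Backward Search (RBS, defined in the context) with sampling function $\lambda(u)=1$ for all $u\in V$ and error parameter $\theta=\tilde{O}(\delta)$. Then with high probability the output satisfies $|\hat{\pi}(s,t)-\pi(s,t)|\le \frac{1}{10}\pi(s,t)$ for every $s\in V$ with $\pi(s,t)>\delta$. Here $\theta$ equals $\delta$ up to a factor polylogarithmic in $n$ and $1/\delta$, and the success probability may be amplified by running $O(\log n)$ independent copies of the algorithm and taking, for each node, the median of the estimates; these overheads are absorbed in the $\tilde O$ notation. The expected worst-case time cost is bounded by $\tilde{O}\!\left(\frac{n\,\pi(t)}{\delta}\right)$. If the target node $t$ is chosen uniformly at random from $V$, the expected time cost is $\tilde{O}\!\left(\frac{1}{\delta}\right)$.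
   Context: $G=(V,E)$ is a directed graph with $n=|V|$, $m=|E|$; $N_{in}(v)$, $N_{out}(u)$ are the in-/out-neighbor sets and $d_{in}(v)$, $d_{out}(u)$ the in-/out-degrees. An $\alpha$-discounted random walk from $s$: at each step it terminates at the current node with probability $\alpha$, and otherwise moves to a uniformly random out-neighbor of the current node. The Personalized PageRank $\pi(s,t)$ is the probability that such a walk from $s$ terminates at $t$; the $\ell$-hop PPR $\pi_\ell(s,t)$ is the probability that it terminates at $t$ after exactly $\ell$ steps, so $\pi(s,t)=\sum_{\ell\ge0}\pi_\ell(s,t)$. The PageRank of $t$ is $\pi(t)=\frac1n\sum_{s\in V}\pi(s,t)$. $\tilde O$ denotes big-O ignoring logarithmic factors. Randomized Backward Search (RBS), with inputs $G$, target $t$, $\alpha$, error parameter $\theta\in(0,1)$, and sampling function $\lambda:V\to(0,\infty)$: Set $L=\log_{1-\alpha}\theta$. Set $\hat\pi_\ell(s,t)=0$ for all $s\in V$ and $\ell=0,\dots,L$, except $\hat\pi_0(t,t)=\alpha$. For $\ell=0,\dots,L-1$, for each $v\in V$ with $\hat\pi_\ell(v,t)\neq0$: (i) for each $u\in N_{in}(v)$ with $d_{out}(u)\le \frac{\lambda(u)(1-\alpha)\hat\pi_\ell(v,t)}{\alpha\theta}$, add $\frac{(1-\alpha)\hat\pi_\ell(v,t)}{d_{out}(u)}$ to $\hat\pi_{\ell+1}(u,t)$; (ii) draw $r$ uniformly from $(0,1)$, independently of all other draws, and for each $u\in N_{in}(v)$ with $\frac{\lambda(u)(1-\alpha)\hat\pi_\ell(v,t)}{\alpha\theta}<d_{out}(u)\le\frac{\lambda(u)(1-\alpha)\hat\pi_\ell(v,t)}{r\,\alpha\theta}$,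 add $\frac{\alpha\theta}{\lambda(u)}$ to $\hat\pi_{\ell+1}(u,t)$. Output $\hat\pi(s,t)=\sum_{\ell=0}^{L}\hat\pi_\ell(s,t)$ for each $s\in V$. In-adjacency lists are pre-sorted by out-degree so each loop scans only the neighbors it updates; the time cost is the number of such update operations. *)

theory Defs
  imports
    "HOL-Probability.Probability"
    "Graph_Theory.Pair_Digraph"
begin

definition out_nbrs :: "'a pair_pre_digraph \<Rightarrow> 'a \<Rightarrow> 'a set" where
  "out_nbrs G u = parcs G `` {u}"

definition in_nbrs :: "'a pair_pre_digraph \<Rightarrow> 'a \<Rightarrow> 'a set" where
  "in_nbrs G v = (parcs G)\<inverse> `` {v}"

abbreviation d_out :: "'a pair_pre_digraph \<Rightarrow> 'a \<Rightarrow> real" where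
  "d_out G u \<equiv> real (out_degree (with_proj G) u)"

text \<open>The distribution of the node at which the discounted walk terminates. A walk that decides
  to move at a node without out-neighbours is lost: it terminates nowhere, since
  \<^term>\<open>spmf_of_set {}\<close> carries no mass. For graphs without such nodes this convention is vacuous.\<close>

partial_function (spmf) discounted_walk :: "'a pair_pre_digraph \<Rightarrow> real \<Rightarrow> 'a \<Rightarrow> 'a spmf" where
  "discounted_walk G \<alpha> v =
     bind_spmf (spmf_of_pmf (bernoulli_pmf \<alpha>))
       (\<lambda>stop. if stop then return_spmf v
               else bind_spmf (spmf_of_set (out_nbrs G v)) (\<lambda>u. discounted_walk G \<alpha> u))"

definition ppr :: "'a pair_pre_digraph \<Rightarrow> real \<Rightarrow> 'a \<Rightarrow> 'a \<Rightarrow> real" where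
  "ppr G \<alpha> s t = spmf (discounted_walk G \<alpha> s) t"

definition pagerank :: "'a pair_pre_digraph \<Rightarrow> real \<Rightarrow> 'a \<Rightarrow> real" where
  "pagerank G \<alpha> t = (\<Sum>s\<in>pverts G. ppr G \<alpha> s t) / real (card (pverts G))"

text \<open>\<open>L = log\<^bsub>1-\<alpha>\<^esub> \<theta>\<close> need not be an integer; the index ranges \<open>0, \<dots>, L\<close> and
  \<open>0, \<dots>, L - 1\<close> then run up to the integer part.\<close>

definition rbs_depth :: "real \<Rightarrow> real \<Rightarrow> nat" where
  "rbs_depth \<alpha> \<theta> = nat \<lfloor>log (1 - \<alpha>) \<theta>\<rfloor>"

text \<open>The in-neighbours of \<open>v\<close> updated by the deterministic and by the randomized loop, where \<open>x\<close> is
  the current estimate at \<open>v\<close> and \<open>\<rho>\<close> the random number drawn for \<open>v\<close>.\<close>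

definition det_updates ::
  "'a pair_pre_digraph \<Rightarrow> real \<Rightarrow> real \<Rightarrow> ('a \<Rightarrow> real) \<Rightarrow> real \<Rightarrow> 'a \<Rightarrow> 'a set" where
  "det_updates G \<alpha> \<theta> lam x v =
     {u \<in> in_nbrs G v. d_out G u \<le> lam u * (1 - \<alpha>) * x / (\<alpha> * \<theta>)}"

definition rand_updates ::
  "'a pair_pre_digraph \<Rightarrow> real \<Rightarrow> real \<Rightarrow> ('a \<Rightarrow> real) \<Rightarrow> real \<Rightarrow> real \<Rightarrow> 'a \<Rightarrow> 'a set" where
  "rand_updates G \<alpha> \<theta> lam \<rho> x v =
     {u \<in> in_nbrs G v. lam u * (1 - \<alpha>) * x / (\<alpha> * \<theta>) < d_out G u \<and>
                       d_out G u \<le> lam u * (1 - \<alpha>) * x / (\<rho> * \<alpha> * \<theta>)}"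

text \<open>\<open>rbs_hop G \<alpha> \<theta> lam t r l u\<close> is the estimate computed for the \<open>l\<close>-hop value of the pair
  \<open>(u, t)\<close>, when \<open>r (l, v)\<close> is the number drawn while processing node \<open>v\<close> in round \<open>l\<close>. The numbers
  are drawn in advance for all pairs \<open>(l, v)\<close>; those of nodes with estimate \<open>0\<close> are never
  used.\<close>

primrec rbs_hop ::
  "'a pair_pre_digraph \<Rightarrow> real \<Rightarrow> real \<Rightarrow> ('a \<Rightarrow> real) \<Rightarrow> 'a \<Rightarrow> (nat \<times> 'a \<Rightarrow> real) \<Rightarrow>
    nat \<Rightarrow> 'a \<Rightarrow> real" where
  "rbs_hop G \<alpha> \<theta> lam t r 0 = (\<lambda>u. if u = t then \<alpha> else 0)"
| "rbs_hop G \<alpha> \<theta> lam t r (Suc l) = (\<lambda>u.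
     \<Sum>v\<in>{v \<in> pverts G. rbs_hop G \<alpha> \<theta> lam t r l v \<noteq> 0}.
       (if u \<in> det_updates G \<alpha> \<theta> lam (rbs_hop G \<alpha> \<theta> lam t r l v) v
        then (1 - \<alpha>) * rbs_hop G \<alpha> \<theta> lam t r l v / d_out G u else 0) +
       (if u \<in> rand_updates G \<alpha> \<theta> lam (r (l, v)) (rbs_hop G \<alpha> \<theta> lam t r l v) v
        then \<alpha> * \<theta> / lam u else 0))"

definition rbs_estimate ::
  "'a pair_pre_digraph \<Rightarrow> real \<Rightarrow> real \<Rightarrow> ('a \<Rightarrow> real) \<Rightarrow> 'a \<Rightarrow> (nat \<times> 'a \<Rightarrow> real) \<Rightarrow>
    'a \<Rightarrow> real" where
  "rbs_estimate G \<alpha> \<theta> lam t r s = (\<Sum>l\<le>rbs_depth \<alpha> \<theta>. rbs_hop G \<alpha> \<theta> lam t r l s)"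

definition rbs_cost ::
  "'a pair_pre_digraph \<Rightarrow> real \<Rightarrow> real \<Rightarrow> ('a \<Rightarrow> real) \<Rightarrow> 'a \<Rightarrow> (nat \<times> 'a \<Rightarrow> real) \<Rightarrow> nat" where
  "rbs_cost G \<alpha> \<theta> lam t r =
     (\<Sum>l<rbs_depth \<alpha> \<theta>. \<Sum>v\<in>{v \<in> pverts G. rbs_hop G \<alpha> \<theta> lam t r l v \<noteq> 0}.
        card (det_updates G \<alpha> \<theta> lam (rbs_hop G \<alpha> \<theta> lam t r l v) v) +
        card (rand_updates G \<alpha> \<theta> lam (r (l, v)) (rbs_hop G \<alpha> \<theta> lam t r l v) v))"

definition median :: "real list \<Rightarrow> real" where
  "median xs =
     (sort xs ! ((length xs - 1) div 2) + sort xs ! (length xs div 2)) / 2"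

text \<open>Joint law of the random numbers of \<open>k\<close> independent copies; component \<open>(i, l, v)\<close> belongs to
  copy \<open>i\<close>, round \<open>l\<close>, node \<open>v\<close>.\<close>

definition rbs_space ::
  "'a pair_pre_digraph \<Rightarrow> real \<Rightarrow> real \<Rightarrow> nat \<Rightarrow> (nat \<times> nat \<times> 'a \<Rightarrow> real) measure" where
  "rbs_space G \<alpha> \<theta> k =
     Pi\<^sub>M ({..<k} \<times> {..<rbs_depth \<alpha> \<theta>} \<times> pverts G)
        (\<lambda>_. uniform_measure lborel {0<..<1})"

definition rbs_median ::
  "'a pair_pre_digraph \<Rightarrow> real \<Rightarrow> real \<Rightarrow> ('a \<Rightarrow> real) \<Rightarrow> nat \<Rightarrow> 'a \<Rightarrow>
    (nat \<times> nat \<times> 'a \<Rightarrow> real) \<Rightarrow> 'a \<Rightarrow> real" where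
  "rbs_median G \<alpha> \<theta> lam k t \<omega> s =
     median (map (\<lambda>i. rbs_estimate G \<alpha> \<theta> lam t (\<lambda>x. \<omega> (i, x)) s) [0..<k])"

definition rbs_total_cost ::
  "'a pair_pre_digraph \<Rightarrow> real \<Rightarrow> real \<Rightarrow> ('a \<Rightarrow> real) \<Rightarrow> nat \<Rightarrow> 'a \<Rightarrow>
    (nat \<times> nat \<times> 'a \<Rightarrow> real) \<Rightarrow> nat" where
  "rbs_total_cost G \<alpha> \<theta> lam k t \<omega> =
     (\<Sum>i<k. rbs_cost G \<alpha> \<theta> lam t (\<lambda>x. \<omega> (i, x)))"

text \<open>The form of the logarithmic factors hidden by soft-O bounds in \<open>n\<close> and \<open>1/\<delta>\<close>; the summand
  \<open>1\<close> keeps them away from \<open>0\<close> near \<open>n = 1\<close>, \<open>\<delta> = 1\<close>.\<close>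

definition polylog :: "nat \<Rightarrow> nat \<Rightarrow> real \<Rightarrow> real" where
  "polylog p n \<delta> = (1 + ln (real n) + ln (1 / \<delta>)) ^ p"

end

theory Submission
  imports
    Defs
    "HOL-Real_Asymp.Real_Asymp"
begin

text \<open>The \<open>\<ell>\<close>-hop values satisfy \<open>\<pi>\<^sub>\<ell>\<^sub>+\<^sub>1 = P \<pi>\<^sub>\<ell>\<close> for the substochastic step matrix \<open>P\<close>, and the
  estimates \<open>X\<^sub>\<ell>\<close> satisfy the same recursion up to fluctuations, each of which is centred given all draws
  but its own. Hence the estimates are unbiased, distinct fluctuations are orthogonal, and
  \<open>Var (X\<^sub>\<ell>(s)) \<le> \<ell> \<alpha> \<theta> \<pi>\<^sub>\<ell>(s)\<close> by induction: convexity carries the old variance through \<open>P\<close>, and the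
  new fluctuations add at most \<open>\<alpha> \<theta> \<pi>\<^sub>\<ell>\<^sub>+\<^sub>1(s)\<close>. With \<open>\<theta>\<close> of order \<open>\<delta> / (1 + ln (1 / \<delta>))\<^sup>2\<close>, Chebyshev's
  inequality makes a single copy accurate at a given node with constant probability, the truncation
  bias being at most \<open>\<theta>\<close>; the median over logarithmically many copies boosts this. Every update adds
  at least \<open>\<alpha> \<theta>\<close> to some estimate, so the expected cost of a copy is at most
  \<open>(\<Sum>u. \<pi>(u, t)) / (\<alpha> \<theta>)\<close>.\<close>

subsection \<open>Product probability spaces\<close>

text \<open>The bound is required at every point of the space and not almost everywhere, so it
  survives overwriting single coordinates, and sums and products stay in the class without null-set
  bookkeeping.\<close>

definition bounded_rv :: "'b measure \<Rightarrow> ('b \<Rightarrow> real) \<Rightarrow> bool" where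
  "bounded_rv M f \<longleftrightarrow> f \<in> borel_measurable M \<and> (\<exists>B. \<forall>\<omega>\<in>space M. \<bar>f \<omega>\<bar> \<le> B)"

lemma bounded_rvI:
  "f \<in> borel_measurable M \<Longrightarrow> (\<And>\<omega>. \<omega> \<in> space M \<Longrightarrow> \<bar>f \<omega>\<bar> \<le> B) \<Longrightarrow> bounded_rv M f"
  unfolding bounded_rv_def by blast

lemma bounded_rv_const: "bounded_rv M (\<lambda>_. c)"
  by (rule bounded_rvI[of _ _ "\<bar>c\<bar>"]) auto

lemma bounded_rv_add:
  assumes "bounded_rv M f" "bounded_rv M g"
  shows "bounded_rv M (\<lambda>\<omega>. f \<omega> + g \<omega>)"
proof -
  obtain A B where "\<And>\<omega>. \<omega> \<in> space M \<Longrightarrow> \<bar>f \<omega>\<bar> \<le> A" "\<And>\<omega>. \<omega> \<in> space M \<Longrightarrow> \<bar>g \<omega>\<bar> \<le> B"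
    using assms unfolding bounded_rv_def by blast
  moreover have "f \<in> borel_measurable M" "g \<in> borel_measurable M"
    using assms by (auto simp: bounded_rv_def)
  ultimately show ?thesis
    by (intro bounded_rvI[of _ _ "A + B"]) (auto intro!: order.trans[OF abs_triangle_ineq add_mono])
qed

lemma bounded_rv_mult:
  assumes "bounded_rv M f" "bounded_rv M g"
  shows "bounded_rv M (\<lambda>\<omega>. f \<omega> * g \<omega>)"
proof -
  obtain A B where A: "\<And>\<omega>. \<omega> \<in> space M \<Longrightarrow> \<bar>f \<omega>\<bar> \<le> A"
    and B: "\<And>\<omega>. \<omega> \<in> space M \<Longrightarrow> \<bar>g \<omega>\<bar> \<le> B"
    using assms unfolding bounded_rv_def by blast
  moreover have "f \<in> borel_measurable M" "g \<in> borel_measurable M"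
    using assms by (auto simp: bounded_rv_def)
  moreover have "\<bar>f \<omega> * g \<omega>\<bar> \<le> A * B" if "\<omega> \<in> space M" for \<omega>
    unfolding abs_mult using A[OF that] B[OF that] by (intro mult_mono) auto
  ultimately show ?thesis
    by (intro bounded_rvI[of _ _ "A * B"]) auto
qed

lemma bounded_rv_diff:
  assumes "bounded_rv M f" "bounded_rv M g"
  shows "bounded_rv M (\<lambda>\<omega>. f \<omega> - g \<omega>)"
  using bounded_rv_add[OF assms(1) bounded_rv_mult[OF bounded_rv_const[of M "-1"] assms(2)]]
  by simp

lemma bounded_rv_power2:
  "bounded_rv M f \<Longrightarrow> bounded_rv M (\<lambda>\<omega>. (f \<omega>)\<^sup>2)"
  unfolding power2_eq_square by (rule bounded_rv_mult)

lemma bounded_rv_sum: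
  assumes "\<And>i. i \<in> A \<Longrightarrow> bounded_rv M (f i)"
  shows "bounded_rv M (\<lambda>\<omega>. \<Sum>i\<in>A. f i \<omega>)"
  using assms
proof (induction A rule: infinite_finite_induct)
  case (insert x F)
  then show ?case by (auto intro: bounded_rv_add)
qed (auto intro: bounded_rv_const)

lemmas bounded_rv_intros =
  bounded_rv_const bounded_rv_add bounded_rv_diff bounded_rv_mult bounded_rv_power2 bounded_rv_sum

lemma (in finite_measure) bounded_rv_integrable: "bounded_rv M f \<Longrightarrow> integrable M f"
  unfolding bounded_rv_def using integrable_const_bound[of f] by fastforce

text \<open>Overwriting one coordinate with an independent draw from its own marginal does not
  change the product law. Fubini then integrates the fresh draw first, with all other coordinates
  frozen; this takes the place of conditional expectations below.\<close>

lemma integral_PiM_resample: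
  fixes M :: "'i \<Rightarrow> 'b measure"
  assumes M: "\<And>j. j \<in> I \<Longrightarrow> prob_space (M j)" and i: "i \<in> I" and f: "bounded_rv (PiM I M) f"
  shows "integral\<^sup>L (PiM I M) f = (\<integral>x. (\<integral>y. f (x(i := y)) \<partial>M i) \<partial>PiM I M)"
proof -
  interpret Mi: prob_space "M i" by (rule M[OF i])
  interpret P: prob_space "PiM I M" by (rule prob_space_PiM[OF M])
  interpret PP: pair_prob_space "M i" "PiM I M" ..
  have m: "(\<lambda>(y, x). x(i := y)) \<in> M i \<Otimes>\<^sub>M PiM I M \<rightarrow>\<^sub>M PiM I M"
  proof -
    have "(\<lambda>p. (snd p)(i := fst p)) \<in> M i \<Otimes>\<^sub>M PiM I M \<rightarrow>\<^sub>M PiM I M"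
      using i by (intro measurable_fun_upd[where J=I]) auto
    then show ?thesis by (simp add: case_prod_beta)
  qed
  obtain B where B: "\<And>x. x \<in> space (PiM I M) \<Longrightarrow> \<bar>f x\<bar> \<le> B"
    using f by (auto simp: bounded_rv_def)
  have [measurable]: "f \<in> borel_measurable (PiM I M)"
    using f by (auto simp: bounded_rv_def)
  \<comment> \<open>The general fact extends the index set by \<open>i\<close>; as \<open>i\<close>
    already lies in \<open>I\<close>, the extended product is \<open>PiM I M\<close> itself and the
    old coordinate is overwritten.\<close>
  have D: "distr (M i \<Otimes>\<^sub>M PiM I M) (PiM I M) (\<lambda>(y, x). x(i := y)) = PiM I M"
    using distr_pair_PiM_eq_PiM[of I M i] M i by (simp add: insert_absorb)
  have int: "integrable (M i \<Otimes>\<^sub>M PiM I M) (\<lambda>(y, x). f (x(i := y)))"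
  proof (rule PP.integrable_const_bound[where B=B])
    show "AE z in M i \<Otimes>\<^sub>M PiM I M. norm (case z of (y, x) \<Rightarrow> f (x(i := y))) \<le> B"
      using measurable_space[OF m] B by (intro AE_I2) auto
    show "(\<lambda>(y, x). f (x(i := y))) \<in> borel_measurable (M i \<Otimes>\<^sub>M PiM I M)"
      using measurable_compose[OF m, of f borel] by (simp add: case_prod_beta)
  qed
  have "integral\<^sup>L (PiM I M) f
      = integral\<^sup>L (distr (M i \<Otimes>\<^sub>M PiM I M) (PiM I M) (\<lambda>(y, x). x(i := y))) f"
    by (simp add: D)
  also have "\<dots> = integral\<^sup>L (M i \<Otimes>\<^sub>M PiM I M) (\<lambda>(y, x). f (x(i := y)))"
    by (subst integral_distr[OF m]) (simp_all add: case_prod_unfold)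
  also have "\<dots> = (\<integral>x. (\<integral>y. f (x(i := y)) \<partial>M i) \<partial>PiM I M)"
    by (rule PP.integral_snd[OF int, symmetric])
  finally show ?thesis .
qed

text \<open>A factor that ignores coordinate \<open>i\<close> leaves the inner integral over that
  coordinate, where \<open>h\<close> averages to zero. The orthogonality relations below all come
  from here.\<close>

lemma integral_PiM_mult_centred_eq_0:
  fixes M :: "'i \<Rightarrow> 'b measure"
  assumes M: "\<And>j. j \<in> I \<Longrightarrow> prob_space (M j)" and i: "i \<in> I"
    and g: "bounded_rv (PiM I M) g" and h: "bounded_rv (PiM I M) h"
    and g_indep: "\<And>x y. g (x(i := y)) = g x"
    and h_centred: "\<And>x. x \<in> space (PiM I M) \<Longrightarrow> (\<integral>y. h (x(i := y)) \<partial>M i) = 0"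
  shows "(\<integral>x. g x * h x \<partial>PiM I M) = 0"
proof -
  have "(\<integral>x. g x * h x \<partial>PiM I M) = (\<integral>x. g x * (\<integral>y. h (x(i := y)) \<partial>M i) \<partial>PiM I M)"
    by (subst integral_PiM_resample[OF M i bounded_rv_mult[OF g h]]) (simp_all add: g_indep)
  also have "\<dots> = (\<integral>x. 0 \<partial>PiM I M)"
    by (rule Bochner_Integration.integral_cong) (auto simp: h_centred)
  finally show ?thesis by simp
qed

lemma indep_vars_PiM_components:
  assumes M: "\<And>i. i \<in> I \<Longrightarrow> prob_space (M i)"
  shows "prob_space.indep_vars (PiM I M) M (\<lambda>i \<omega>. \<omega> i) I"
proof (cases "I = {}")
  case True
  interpret prob_space "PiM I M" by (rule prob_space_PiM[OF M])
  show ?thesis unfolding indep_vars_def2 indep_sets_def by (auto simp: True)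
next
  case False
  interpret prob_space "PiM I M" by (rule prob_space_PiM[OF M])
  have "distr (PiM I M) (PiM I M) (\<lambda>x. \<lambda>i\<in>I. x i) = distr (PiM I M) (PiM I M) (\<lambda>x. x)"
    by (rule distr_cong) (auto simp: space_PiM)
  also have "\<dots> = PiM I (\<lambda>i. distr (PiM I M) (M i) (\<lambda>\<omega>. \<omega> i))"
    by (simp add: distr_id, rule PiM_cong) (simp_all add: distr_PiM_component M)
  finally show ?thesis
    by (subst indep_vars_iff_distr_eq_PiM'[OF False]) auto
qed

text \<open>\<open>g_restrict\<close> says that \<open>g j\<close> reads only the coordinates in
  \<open>K j\<close>. Functions of disjoint blocks of coordinates are independent, so the mean of
  the product factors; later each block holds the draws of one copy.\<close>

lemma integral_PiM_prod_blocks: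
  fixes M :: "'i \<Rightarrow> 'b measure" and g :: "'j \<Rightarrow> ('i \<Rightarrow> 'b) \<Rightarrow> real"
  assumes M: "\<And>i. i \<in> I \<Longrightarrow> prob_space (M i)" and fin: "finite J"
    and K: "\<And>j. j \<in> J \<Longrightarrow> K j \<subseteq> I" and disj: "disjoint_family_on K J"
    and g: "\<And>j. j \<in> J \<Longrightarrow> bounded_rv (PiM (K j) M) (g j)"
    and g_restrict: "\<And>j \<omega>. j \<in> J \<Longrightarrow> g j (restrict \<omega> (K j)) = g j \<omega>"
  shows "(\<integral>\<omega>. (\<Prod>j\<in>J. g j \<omega>) \<partial>PiM I M) = (\<Prod>j\<in>J. (\<integral>\<omega>. g j \<omega> \<partial>PiM I M))"
proof -
  interpret prob_space "PiM I M" by (rule prob_space_PiM[OF M])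
  have 1: "indep_vars (\<lambda>j. PiM (K j) M) (\<lambda>j \<omega>. \<lambda>i\<in>K j. \<omega> i) J"
    using indep_vars_restrict[OF indep_vars_PiM_components[OF M] K disj] by simp
  have "indep_vars (\<lambda>_. borel) (\<lambda>j \<omega>. g j (\<lambda>i\<in>K j. \<omega> i)) J"
    by (rule indep_vars_compose2[OF 1]) (use g in \<open>auto simp: bounded_rv_def\<close>)
  then have ind: "indep_vars (\<lambda>_. borel) g J"
    by (subst indep_vars_cong[OF refl _ refl, where Y = "\<lambda>j \<omega>. g j (\<lambda>i\<in>K j. \<omega> i)"])
       (auto simp: g_restrict)
  show ?thesis
  proof (rule indep_vars_lebesgue_integral[OF fin ind])
    fix j assume j: "j \<in> J"
    obtain B where B: "\<And>\<omega>. \<omega> \<in> space (PiM (K j) M) \<Longrightarrow> \<bar>g j \<omega>\<bar> \<le> B"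
      using g[OF j] by (auto simp: bounded_rv_def)
    have "\<bar>g j \<omega>\<bar> \<le> B" if "\<omega> \<in> space (PiM I M)" for \<omega>
    proof -
      have "restrict \<omega> (K j) \<in> space (PiM (K j) M)"
        using that K[OF j] by (auto simp: space_PiM)
      from B[OF this] show ?thesis by (simp add: g_restrict[OF j])
    qed
    then show "integrable (PiM I M) (g j)"
      using ind j by (intro integrable_const_bound[where B=B]) (auto simp: indep_vars_def)
  qed
qed

subsection \<open>Medians\<close>

text \<open>By the first assumption \<open>P\<close> passes to earlier positions, so it holds
  exactly on an initial segment of the list, whose length is the count.\<close>

lemma sorted_nth_iff_count:
  fixes ys :: "'b list"
  assumes "\<And>i j. i \<le> j \<Longrightarrow> j < length ys \<Longrightarrow> P (ys ! j) \<Longrightarrow> P (ys ! i)" "j < length ys"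
  shows "P (ys ! j) \<longleftrightarrow> j < length (filter P ys)"
proof
  assume "P (ys ! j)"
  then have "{..j} \<subseteq> {i. i < length ys \<and> P (ys ! i)}" using assms by fastforce
  from card_mono[OF _ this] show "j < length (filter P ys)"
    by (simp add: length_filter_conv_card)
next
  assume c: "j < length (filter P ys)"
  show "P (ys ! j)"
  proof (rule ccontr)
    assume "\<not> P (ys ! j)"
    then have "{i. i < length ys \<and> P (ys ! i)} \<subseteq> {..<j}"
      using assms by (auto simp: not_less) (meson leI)
    from card_mono[OF _ this] c show False
      by (simp add: length_filter_conv_card)
  qed
qed

lemma length_filter_sort: "length (filter P (sort xs)) = length (filter P xs)"
  by (metis filter_sort length_sort)

lemma sort_nth_le_iff:
  fixes xs :: "real list"
  assumes "j < length xs"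
  shows "sort xs ! j \<le> a \<longleftrightarrow> j < length (filter (\<lambda>x. x \<le> a) xs)"
proof -
  have "sort xs ! i \<le> a" if "i \<le> j'" "j' < length (sort xs)" "sort xs ! j' \<le> a" for i j'
    using sorted_nth_mono[OF sorted_sort that(1,2)] that(3) by linarith
  from sorted_nth_iff_count[of "sort xs" "\<lambda>x. x \<le> a" j, OF this] show ?thesis
    using assms by (simp add: length_filter_sort)
qed

lemma sort_nth_less_iff:
  fixes xs :: "real list"
  assumes "j < length xs"
  shows "sort xs ! j < a \<longleftrightarrow> j < length (filter (\<lambda>x. x < a) xs)"
proof -
  have "sort xs ! i < a" if "i \<le> j'" "j' < length (sort xs)" "sort xs ! j' < a" for i j'
    using sorted_nth_mono[OF sorted_sort that(1,2)] that(3) by linarith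
  from sorted_nth_iff_count[of "sort xs" "\<lambda>x. x < a" j, OF this] show ?thesis
    using assms by (simp add: length_filter_sort)
qed

text \<open>Fewer than half of the entries are bad, so too few lie below \<open>m - e\<close> to
  reach the lower middle position, and enough lie at or below \<open>m + e\<close> to cover the
  upper one. The mean of the two middle entries stays between these bounds.\<close>

lemma median_deviation_le:
  fixes m e :: real
  assumes maj: "2 * length (filter (\<lambda>x. \<bar>x - m\<bar> > e) xs) < length xs"
  shows "\<bar>median xs - m\<bar> \<le> e"
proof -
  let ?n = "length xs" and ?bad = "length (filter (\<lambda>x. \<bar>x - m\<bar> > e) xs)"
  let ?i = "(?n - 1) div 2" and ?j = "?n div 2"
  have n: "?i < ?n" "?j < ?n" "?i \<le> ?j" using maj by auto
  have "length (filter (\<lambda>x. x < m - e) ys) \<le> length (filter (\<lambda>x. \<bar>x - m\<bar> > e) ys)" for ys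
    by (induction ys) auto
  from this[of xs] have "\<not> sort xs ! ?i < m - e"
    unfolding sort_nth_less_iff[OF n(1)] using maj by linarith
  moreover have "length ys \<le> length (filter (\<lambda>x. x \<le> m + e) ys) + length (filter (\<lambda>x. \<bar>x - m\<bar> > e) ys)" for ys
    by (induction ys) auto
  from this[of xs] have "sort xs ! ?j \<le> m + e"
    unfolding sort_nth_le_iff[OF n(2)] using maj by linarith
  moreover have "sort xs ! ?i \<le> sort xs ! ?j"
    using n by (intro sorted_nth_mono) auto
  ultimately show ?thesis by (auto simp: median_def abs_le_iff field_simps)
qed

text \<open>An order statistic is at most \<open>a\<close> exactly when more than \<open>j\<close>
  of the variables are, and this count is a finite sum of measurable indicators.\<close>

lemma borel_measurable_sort_nth:
  fixes X :: "nat \<Rightarrow> 'b \<Rightarrow> real"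
  assumes X[measurable]: "\<And>i. i < k \<Longrightarrow> X i \<in> borel_measurable M" and j: "j < k"
  shows "(\<lambda>\<omega>. sort (map (\<lambda>i. X i \<omega>) [0..<k]) ! j) \<in> borel_measurable M"
proof -
  have eq: "sort (map (\<lambda>i. X i \<omega>) [0..<k]) ! j \<le> a
      \<longleftrightarrow> real j < (\<Sum>i<k. indicator {\<omega>. X i \<omega> \<le> a} \<omega>)" for \<omega> a
  proof -
    have "{i. i < k \<and> X i \<omega> \<le> a} = {i \<in> {..<k}. X i \<omega> \<le> a}" by auto
    then have "length (filter (\<lambda>x. x \<le> a) (map (\<lambda>i. X i \<omega>) [0..<k]))
        = card {i \<in> {..<k}. X i \<omega> \<le> a}"
      by (auto simp: length_filter_conv_card intro!: arg_cong[where f=card])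
    moreover have "(\<Sum>i<k. indicator {\<omega>. X i \<omega> \<le> a} \<omega>) = real (card {i \<in> {..<k}. X i \<omega> \<le> a})"
      by (simp add: indicator_def sum.If_cases Int_def)
    ultimately show ?thesis
      using sort_nth_le_iff[of j "map (\<lambda>i. X i \<omega>) [0..<k]" a] j by simp
  qed
  have "{\<omega> \<in> space M. real j < (\<Sum>i<k. indicator {\<omega>. X i \<omega> \<le> a} \<omega>)} \<in> sets M" for a
  proof -
    have [measurable]: "(\<lambda>\<omega>. indicator {\<omega>. X i \<omega> \<le> a} \<omega> :: real) \<in> borel_measurable M"
      if "i \<in> {..<k}" for i
      using that by (auto simp: indicator_def)
    show ?thesis by measurable
  qed
  then show ?thesis unfolding borel_measurable_iff_le eq by blast
qed

lemma borel_measurable_median: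
  fixes X :: "nat \<Rightarrow> 'b \<Rightarrow> real"
  assumes "\<And>i. i < k \<Longrightarrow> X i \<in> borel_measurable M" "0 < k"
  shows "(\<lambda>\<omega>. median (map (\<lambda>i. X i \<omega>) [0..<k])) \<in> borel_measurable M"
proof -
  have "(k - 1) div 2 < k" "k div 2 < k"
    using assms(2) by auto
  then show ?thesis
    unfolding median_def length_map length_upt diff_zero
    by (intro borel_measurable_divide borel_measurable_add borel_measurable_const
        borel_measurable_sort_nth assms)
qed

subsection \<open>Hop values and their estimates\<close>

locale walk_graph =
  fixes G :: "'a pair_pre_digraph" and \<alpha> :: real and t :: 'a
  assumes G: "pair_fin_digraph G" and t: "t \<in> pverts G" and \<alpha>: "0 < \<alpha>" "\<alpha> < 1"
begin

lemma finite_verts: "finite (pverts G)" and finite_arcs: "finite (parcs G)"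
  using G by (auto simp: pair_fin_digraph_def pair_fin_digraph_axioms_def)

lemma arc_verts: "(u, v) \<in> parcs G \<Longrightarrow> u \<in> pverts G \<and> v \<in> pverts G"
  using G by (auto simp: pair_fin_digraph_def pair_wf_digraph_def)

lemma finite_out_nbrs: "finite (out_nbrs G u)"
  using finite_arcs by (simp add: out_nbrs_def finite_Image)

lemma out_nbrs_subset: "out_nbrs G u \<subseteq> pverts G"
  using arc_verts by (auto simp: out_nbrs_def)

lemma in_nbrs_subset: "in_nbrs G v \<subseteq> pverts G"
  using arc_verts by (auto simp: in_nbrs_def)

lemma d_out_eq: "d_out G u = real (card (out_nbrs G u))"
proof -
  have "out_arcs (with_proj G) u = Pair u ` out_nbrs G u"
    by (auto simp: out_arcs_def out_nbrs_def)
  then show ?thesis by (simp add: out_degree_def card_image inj_on_def)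
qed

lemma d_out_ge_1: "(u, v) \<in> parcs G \<Longrightarrow> 1 \<le> d_out G u"
  using finite_out_nbrs[of u] by (auto simp: d_out_eq out_nbrs_def card_gt_0_iff Suc_le_eq)

text \<open>The matrix \<open>P\<close> of the overview: the probability that the walk at
  \<open>u\<close> does not stop and moves to \<open>v\<close>. The row of a node without
  out-neighbours is zero, matching the walks that are lost there.\<close>

definition step_weight :: "'a \<Rightarrow> 'a \<Rightarrow> real" where
  "step_weight u v = (if (u, v) \<in> parcs G then (1 - \<alpha>) / d_out G u else 0)"

lemma step_weight_nonneg: "0 \<le> step_weight u v"
  using \<alpha> by (simp add: step_weight_def)

lemma sum_step_weight: "(\<Sum>v\<in>pverts G. step_weight u v * f v)
    = (1 - \<alpha>) * (\<Sum>v\<in>out_nbrs G u. f v) / card (out_nbrs G u)"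
proof -
  have "(\<Sum>v\<in>pverts G. step_weight u v * f v)
      = (\<Sum>v\<in>out_nbrs G u. (1 - \<alpha>) / card (out_nbrs G u) * f v)"
    using finite_verts out_nbrs_subset
    by (intro sum.mono_neutral_cong_right) (auto simp: step_weight_def d_out_eq out_nbrs_def)
  then show ?thesis by (simp add: sum_distrib_left sum_divide_distrib)
qed

lemma sum_step_weight_le: "(\<Sum>v\<in>pverts G. step_weight u v) \<le> 1 - \<alpha>"
  using sum_step_weight[of u "\<lambda>_. 1"] \<alpha> by (cases "card (out_nbrs G u) = 0") auto

text \<open>First-step analysis by one unfolding of the walk. At a node without out-neighbours the
  quotient by the out-degree is 0, in agreement with the mass lost in
  \<open>spmf_of_set {}\<close>.\<close>

lemma ppr_rec:
  "ppr G \<alpha> u v = (if u = v then \<alpha> else 0) + (\<Sum>w\<in>pverts G. step_weight u w * ppr G \<alpha> w v)"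
proof -
  have ret: "spmf (return_spmf u) v = (if u = v then 1 else 0)"
    by (simp add: pmf_return)
  have "ppr G \<alpha> u v = \<alpha> * (if u = v then 1 else 0)
     + (1 - \<alpha>) * ((\<Sum>w\<in>out_nbrs G u. ppr G \<alpha> w v) / card (out_nbrs G u))"
    unfolding ppr_def
    by (subst discounted_walk.simps)
       (use \<alpha> in \<open>simp add: spmf_bind integral_spmf_of_set ret del: bind_spmf_of_pmf pmf_return\<close>)
  then show ?thesis by (simp add: sum_step_weight)
qed

lemma ppr_nonneg: "0 \<le> ppr G \<alpha> u v" by (simp add: ppr_def)

lemma ppr_le_1: "ppr G \<alpha> u v \<le> 1" by (simp add: ppr_def pmf_le_1)

lemma sum_ppr_le_1: "(\<Sum>v\<in>pverts G. ppr G \<alpha> u v) \<le> 1"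
proof -
  have "(\<Sum>v\<in>pverts G. ppr G \<alpha> u v) = measure (measure_spmf (discounted_walk G \<alpha> u)) (pverts G)"
    unfolding ppr_def
    by (subst measure_spmf.finite_measure_eq_sum_singleton) (auto simp: finite_verts spmf_conv_measure_spmf)
  then show ?thesis by (simp add: measure_spmf.subprob_measure_le_1)
qed

text \<open>The hop values for the fixed target are introduced by their recursion instead of by
  walks of a given length; \<open>ppr_minus_hops\<close> ties them to \<open>ppr\<close>.\<close>

primrec hop_ppr :: "nat \<Rightarrow> 'a \<Rightarrow> real" where
  "hop_ppr 0 = (\<lambda>u. if u = t then \<alpha> else 0)"
| "hop_ppr (Suc l) = (\<lambda>u. \<Sum>v\<in>pverts G. step_weight u v * hop_ppr l v)"

lemma hop_ppr_nonneg: "0 \<le> hop_ppr l u"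
  using \<alpha> by (induction l arbitrary: u) (auto intro!: sum_nonneg mult_nonneg_nonneg step_weight_nonneg)

text \<open>The remainder is the probability of terminating at \<open>t\<close> after at least
  \<open>m\<close> steps. Increasing \<open>m\<close> by one applies \<open>P\<close> to it, it
  starts between 0 and 1, and every row of \<open>P\<close> sums to at most
  \<open>1 - \<alpha>\<close>.\<close>

lemma ppr_minus_hops:
  "0 \<le> ppr G \<alpha> s t - (\<Sum>l<m. hop_ppr l s) \<and> ppr G \<alpha> s t - (\<Sum>l<m. hop_ppr l s) \<le> (1 - \<alpha>) ^ m"
proof (induction m arbitrary: s)
  case 0
  show ?case by (simp add: ppr_nonneg ppr_le_1)
next
  case (Suc m)
  \<comment> \<open>Hop 0 is split off rather than the last hop, so that it cancels against the
    stopping term of \<open>ppr_rec\<close>.\<close>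
  have "(\<Sum>l<Suc m. hop_ppr l s)
      = hop_ppr 0 s + (\<Sum>v\<in>pverts G. step_weight s v * (\<Sum>l<m. hop_ppr l v))"
    unfolding sum.lessThan_Suc_shift by (simp add: sum_distrib_left sum.swap[of _ "pverts G"])
  then have eq: "ppr G \<alpha> s t - (\<Sum>l<Suc m. hop_ppr l s)
      = (\<Sum>v\<in>pverts G. step_weight s v * (ppr G \<alpha> v t - (\<Sum>l<m. hop_ppr l v)))"
    by (subst ppr_rec) (simp add: sum_subtractf right_diff_distrib)
  have "(\<Sum>v\<in>pverts G. step_weight s v * (ppr G \<alpha> v t - (\<Sum>l<m. hop_ppr l v)))
      \<le> (\<Sum>v\<in>pverts G. step_weight s v * (1 - \<alpha>) ^ m)"
    using Suc.IH step_weight_nonneg by (intro sum_mono mult_left_mono) auto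
  also have "\<dots> \<le> (1 - \<alpha>) * (1 - \<alpha>) ^ m"
    unfolding sum_distrib_right[symmetric] using sum_step_weight_le \<alpha> by (intro mult_right_mono) auto
  finally show ?case
    unfolding eq using Suc.IH step_weight_nonneg by (auto intro!: sum_nonneg mult_nonneg_nonneg)
qed

lemma sum_hop_ppr_le: "(\<Sum>l<m. hop_ppr l s) \<le> ppr G \<alpha> s t"
  using ppr_minus_hops[of s m] by linarith

end

text \<open>The estimate keeps the levels 0 to \<open>rbs_depth\<close>, so the first omitted level
  is its successor. That number exceeds the logarithm despite the rounding down, and powers of a
  base below 1 decrease.\<close>

lemma depth_power_le:
  assumes "0 < \<alpha>" "\<alpha> < 1" "0 < \<theta>" "\<theta> < 1"
  shows "(1 - \<alpha>) ^ Suc (rbs_depth \<alpha> \<theta>) \<le> \<theta>"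
proof -
  have "log (1 - \<alpha>) \<theta> < real (Suc (rbs_depth \<alpha> \<theta>))"
    unfolding rbs_depth_def by linarith
  then have "(1 - \<alpha>) powr real (Suc (rbs_depth \<alpha> \<theta>)) \<le> (1 - \<alpha>) powr log (1 - \<alpha>) \<theta>"
    using assms by (intro powr_mono') auto
  then show ?thesis
    using assms powr_realpow[of "1 - \<alpha>" "Suc (rbs_depth \<alpha> \<theta>)"]
    by (simp del: power_Suc of_nat_Suc)
qed

lemma rbs_depth_le:
  assumes "0 < \<alpha>" "\<alpha> < 1" "0 < \<theta>" "\<theta> < 1"
  shows "real (rbs_depth \<alpha> \<theta>) \<le> ln (1 / \<theta>) / ln (1 / (1 - \<alpha>))"
proof -
  have "log (1 - \<alpha>) \<theta> = ln (1 / \<theta>) / ln (1 / (1 - \<alpha>))"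
    using assms by (simp add: log_def ln_div)
  moreover have "0 \<le> ln (1 / \<theta>) / ln (1 / (1 - \<alpha>))"
    using assms by (intro divide_nonneg_nonneg) auto
  ultimately show ?thesis unfolding rbs_depth_def by linarith
qed

abbreviation unif01 :: "real measure" where
  "unif01 \<equiv> uniform_measure lborel {0<..<1}"

lemma prob_space_unif01: "prob_space unif01"
  by (rule prob_space_uniform_measure) auto

lemma measure_unif01_atMost: "0 \<le> q \<Longrightarrow> q < 1 \<Longrightarrow> measure unif01 {..q} = q"
proof -
  assume q: "0 \<le> q" "q < 1"
  have "{0<..<1} \<inter> {..q} = {0<..q}" using q by auto
  then show ?thesis using q by (simp add: measure_uniform_measure)
qed

text \<open>With q the probability of the event, the variance is \<open>a^2 q (1 - q)\<close>, at
  most \<open>a\<close> times the mean. Keeping the mean in the bound later makes the variance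
  proportional to the value being estimated.\<close>

lemma (in prob_space) moments_scaled_indicator:
  assumes A: "A \<in> events"
  shows "(\<integral>x. a * indicator A x \<partial>M) = a * prob A"
    and "(\<integral>x. (a * indicator A x - a * prob A)\<^sup>2 \<partial>M) \<le> a * (a * prob A)"
proof -
  show "(\<integral>x. a * indicator A x \<partial>M) = a * prob A" using A by simp
  have "(\<integral>x. (a * indicator A x - a * prob A)\<^sup>2 \<partial>M)
     = (\<integral>x. a\<^sup>2 * (1 - 2 * prob A) * indicator A x + (a * prob A)\<^sup>2 \<partial>M)"
    by (rule Bochner_Integration.integral_cong)
       (auto simp: power2_eq_square algebra_simps split: split_indicator)
  also have "\<dots> = a\<^sup>2 * (1 - 2 * prob A) * prob A + (a * prob A)\<^sup>2"
    using A by (subst Bochner_Integration.integral_add) (auto simp: prob_space less_top[symmetric])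
  also have "\<dots> \<le> a * (a * prob A)"
    using zero_le_square[of "a * prob A"] by (simp add: power2_eq_square algebra_simps)
  finally show "(\<integral>x. (a * indicator A x - a * prob A)\<^sup>2 \<partial>M) \<le> a * (a * prob A)" .
qed

section \<open>A single run: unbiased randomized rounding\<close>

locale rbs_run = walk_graph G \<alpha> t for G :: "'a pair_pre_digraph" and \<alpha> t +
  fixes \<theta> :: real
  assumes \<theta>: "0 < \<theta>" "\<theta> < 1"
begin

abbreviation "L \<equiv> rbs_depth \<alpha> \<theta>"

text \<open>What processing \<open>v\<close> with estimate \<open>x\<close> adds to \<open>u\<close>
  when the sampling function is constantly 1. The two update sets are disjoint, so at most one
  summand is nonzero.\<close>

definition contribution :: "real \<Rightarrow> real \<Rightarrow> 'a \<Rightarrow> 'a \<Rightarrow> real" where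
  "contribution \<rho> x u v =
     (if u \<in> det_updates G \<alpha> \<theta> (\<lambda>_. 1) x v then (1 - \<alpha>) * x / d_out G u else 0) +
     (if u \<in> rand_updates G \<alpha> \<theta> (\<lambda>_. 1) \<rho> x v then \<alpha> * \<theta> else 0)"

lemma in_det_updates: "u \<in> det_updates G \<alpha> \<theta> (\<lambda>_. 1) x v
    \<longleftrightarrow> (u, v) \<in> parcs G \<and> d_out G u \<le> (1 - \<alpha>) * x / (\<alpha> * \<theta>)"
  by (auto simp: det_updates_def in_nbrs_def)

lemma in_rand_updates: "u \<in> rand_updates G \<alpha> \<theta> (\<lambda>_. 1) \<rho> x v
    \<longleftrightarrow> (u, v) \<in> parcs G \<and> (1 - \<alpha>) * x / (\<alpha> * \<theta>) < d_out G u
        \<and> d_out G u \<le> (1 - \<alpha>) * x / (\<rho> * \<alpha> * \<theta>)"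
  by (auto simp: rand_updates_def in_nbrs_def)

text \<open>Permits the sum in the recursion to range over all nodes instead of those with nonzero
  estimate.\<close>

lemma contribution_0: "contribution \<rho> 0 u v = 0"
  by (auto simp: contribution_def in_rand_updates)

lemma contribution_nonneg: "0 \<le> x \<Longrightarrow> 0 \<le> contribution \<rho> x u v"
  using \<alpha> \<theta> by (auto simp: contribution_def)

lemma contribution_le: "0 \<le> x \<Longrightarrow> contribution \<rho> x u v \<le> x + \<alpha> * \<theta>"
proof -
  assume x: "0 \<le> x"
  have "(1 - \<alpha>) * x / d_out G u \<le> x" if "(u, v) \<in> parcs G"
  proof -
    have "(1 - \<alpha>) * x / d_out G u \<le> 1 * x / 1"
      using d_out_ge_1[OF that] \<alpha> x by (intro frac_le mult_right_mono) auto
    then show ?thesis by simp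
  qed
  then show ?thesis
    using x \<alpha> \<theta> by (auto simp: contribution_def in_det_updates in_rand_updates intro!: add_increasing2)
qed

text \<open>For positive \<open>\<rho>\<close> the upper cutoff on the out-degree can be solved for
  \<open>\<rho>\<close>. An increment below \<open>\<alpha> * \<theta>\<close> is thus rounded at
  random to \<open>\<alpha> * \<theta>\<close> or 0, its ratio to \<open>\<alpha> * \<theta>\<close>
  being the threshold for the draw.\<close>

lemma contribution_eq:
  assumes "0 \<le> x" "0 < \<rho>" "\<rho> < 1"
  shows "contribution \<rho> x u v = (if u \<in> det_updates G \<alpha> \<theta> (\<lambda>_. 1) x v \<or> (u, v) \<notin> parcs G
    then step_weight u v * x
    else \<alpha> * \<theta> * indicator {..step_weight u v * x / (\<alpha> * \<theta>)} \<rho>)"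
proof (cases "(u, v) \<in> parcs G")
  case True
  have "d_out G u \<le> (1 - \<alpha>) * x / (\<rho> * \<alpha> * \<theta>) \<longleftrightarrow> \<rho> \<le> (1 - \<alpha>) / d_out G u * x / (\<alpha> * \<theta>)"
    using d_out_ge_1[OF True] assms \<alpha> \<theta> by (simp add: field_simps)
  then show ?thesis using True
    by (auto simp: contribution_def in_det_updates in_rand_updates step_weight_def indicator_def)
next
  case False
  then show ?thesis
    by (auto simp: contribution_def in_det_updates in_rand_updates step_weight_def)
qed

lemma borel_measurable_contribution:
  assumes [measurable]: "f \<in> borel_measurable M" "g \<in> borel_measurable M"
  shows "(\<lambda>\<omega>. contribution (f \<omega>) (g \<omega>) u v) \<in> borel_measurable M"
  unfolding contribution_def in_det_updates in_rand_updates by measurable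

lemma
  assumes x: "0 \<le> x"
  shows integral_contribution: "(\<integral>\<rho>. contribution \<rho> x u v \<partial>unif01) = step_weight u v * x"
    and variance_contribution:
      "(\<integral>\<rho>. (contribution \<rho> x u v - step_weight u v * x)\<^sup>2 \<partial>unif01) \<le> \<alpha> * \<theta> * (step_weight u v * x)"
proof -
  interpret U: prob_space unif01 by (rule prob_space_unif01)
  define B where "B \<longleftrightarrow> u \<in> det_updates G \<alpha> \<theta> (\<lambda>_. 1) x v \<or> (u, v) \<notin> parcs G"
  define q where "q = step_weight u v * x / (\<alpha> * \<theta>)"
  define h where "h \<rho> = (if B then step_weight u v * x else \<alpha> * \<theta> * indicator {..q} \<rho>)" for \<rho> :: real
  have wx: "0 \<le> step_weight u v * x" using x step_weight_nonneg by simp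
  \<comment> \<open>The closed form is available for draws in the open unit interval, which carries
    the whole uniform measure.\<close>
  have AE: "AE \<rho> in unif01. contribution \<rho> x u v = h \<rho>"
    by (rule AE_uniform_measureI) (auto simp: h_def B_def q_def contribution_eq[OF x])
  have meas[measurable]: "(\<lambda>\<rho>. contribution \<rho> x u v) \<in> borel_measurable unif01"
    by (rule borel_measurable_contribution) auto
  have meas_h[measurable]: "h \<in> borel_measurable unif01" unfolding h_def by auto
  have 1: "(\<integral>\<rho>. contribution \<rho> x u v \<partial>unif01) = integral\<^sup>L unif01 h"
    using AE by (intro integral_cong_AE) auto
  have 2: "(\<integral>\<rho>. (contribution \<rho> x u v - step_weight u v * x)\<^sup>2 \<partial>unif01)
      = (\<integral>\<rho>. (h \<rho> - step_weight u v * x)\<^sup>2 \<partial>unif01)"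
    using AE by (intro integral_cong_AE) (auto elim!: eventually_mono)
  have *: "integral\<^sup>L unif01 h = step_weight u v * x \<and>
      (\<integral>\<rho>. (h \<rho> - step_weight u v * x)\<^sup>2 \<partial>unif01) \<le> \<alpha> * \<theta> * (step_weight u v * x)"
  proof (cases B)
    case True
    then have "h = (\<lambda>_. step_weight u v * x)" by (auto simp: h_def)
    then show ?thesis using wx \<alpha> \<theta> by (simp add: U.prob_space)
  next
    case False
    then have arc: "(u, v) \<in> parcs G" and d: "(1 - \<alpha>) * x / (\<alpha> * \<theta>) < d_out G u"
      by (auto simp: B_def in_det_updates)
    \<comment> \<open>Failure of the deterministic threshold is exactly \<open>q < 1\<close>, so
      \<open>q\<close> is a genuine probability and the rounding is unbiased.\<close>
    have q: "0 \<le> q" "q < 1" "\<alpha> * \<theta> * q = step_weight u v * x"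
      using wx \<alpha> \<theta> d d_out_ge_1[OF arc] arc by (auto simp: q_def step_weight_def field_simps)
    have m: "measure unif01 {..q} = q" by (rule measure_unif01_atMost) fact+
    show ?thesis
      using U.moments_scaled_indicator[of "{..q}" "\<alpha> * \<theta>"] False
      unfolding m q(3) h_def by simp
  qed
  then show "(\<integral>\<rho>. contribution \<rho> x u v \<partial>unif01) = step_weight u v * x"
    "(\<integral>\<rho>. (contribution \<rho> x u v - step_weight u v * x)\<^sup>2 \<partial>unif01) \<le> \<alpha> * \<theta> * (step_weight u v * x)"
    unfolding 1 2 by auto
qed

abbreviation hop_est :: "(nat \<times> 'a \<Rightarrow> real) \<Rightarrow> nat \<Rightarrow> 'a \<Rightarrow> real" where
  "hop_est r \<equiv> rbs_hop G \<alpha> \<theta> (\<lambda>_. 1) t r"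

lemma hop_est_Suc: "hop_est r (Suc l) u = (\<Sum>v\<in>pverts G. contribution (r (l, v)) (hop_est r l v) u v)"
proof -
  have "hop_est r (Suc l) u
      = (\<Sum>v\<in>{v \<in> pverts G. hop_est r l v \<noteq> 0}. contribution (r (l, v)) (hop_est r l v) u v)"
    by (simp only: contribution_def rbs_hop.simps(2) div_by_1)
  also have "\<dots> = (\<Sum>v\<in>pverts G. contribution (r (l, v)) (hop_est r l v) u v)"
    by (rule sum.mono_neutral_left) (auto simp: finite_verts contribution_0)
  finally show ?thesis .
qed

lemma hop_est_nonneg: "0 \<le> hop_est r l u"
proof (induction l arbitrary: u)
  case 0
  then show ?case using \<alpha> by simp
next
  case (Suc l)
  then show ?case unfolding hop_est_Suc by (intro sum_nonneg contribution_nonneg)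
qed

text \<open>The bound must be uniform in \<open>r\<close>: the sample space contains arbitrary real
  draws, not only those in the unit interval. A crude bound that grows with the level is enough for
  integrability.\<close>

lemma hop_est_bounded: "\<exists>B. \<forall>r u. hop_est r l u \<le> B"
proof (induction l)
  case 0
  show ?case using \<alpha> by (intro exI[of _ \<alpha>]) auto
next
  case (Suc l)
  then obtain B where B: "\<And>r u. hop_est r l u \<le> B" by blast
  have "hop_est r (Suc l) u \<le> (\<Sum>v\<in>pverts G. B + \<alpha> * \<theta>)" for r u
    unfolding hop_est_Suc
    by (intro sum_mono order.trans[OF contribution_le] hop_est_nonneg add_right_mono B)
  then show ?case by blast
qed

text \<open>The estimates of level \<open>l\<close> read only the draws of earlier rounds, which
  makes the draws of round \<open>l\<close> fresh relative to them.\<close>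

lemma hop_est_cong:
  assumes "\<And>j v. j < l \<Longrightarrow> v \<in> pverts G \<Longrightarrow> r (j, v) = r' (j, v)"
  shows "hop_est r l u = hop_est r' l u"
  using assms
proof (induction l arbitrary: u)
  case (Suc l)
  then have "hop_est r l v = hop_est r' l v" for v by simp
  then show ?case unfolding hop_est_Suc using Suc.prems by (intro sum.cong) auto
qed simp

lemma borel_measurable_hop_est:
  assumes "\<And>j v. j < l \<Longrightarrow> v \<in> pverts G \<Longrightarrow> (\<lambda>\<omega>. r \<omega> (j, v)) \<in> borel_measurable M"
  shows "(\<lambda>\<omega>. hop_est (r \<omega>) l u) \<in> borel_measurable M"
  using assms
proof (induction l arbitrary: u)
  case (Suc l)
  then have "(\<lambda>\<omega>. hop_est (r \<omega>) l v) \<in> borel_measurable M" for v by simp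
  then show ?case unfolding hop_est_Suc
    using Suc.prems by (intro borel_measurable_sum borel_measurable_contribution) auto
qed simp

text \<open>Charging argument: a deterministic update adds at least
  \<open>\<alpha> * \<theta>\<close> by its threshold, a randomized one exactly that much. The
  updates of round \<open>l\<close> are thus paid for by the total mass of the estimates at level
  \<open>l + 1\<close>.\<close>

lemma rbs_cost_le:
  "\<alpha> * \<theta> * rbs_cost G \<alpha> \<theta> (\<lambda>_. 1) t r \<le> (\<Sum>u\<in>pverts G. \<Sum>l\<le>L. hop_est r l u)"
proof -
  let ?D = "\<lambda>l v. det_updates G \<alpha> \<theta> (\<lambda>_. 1) (hop_est r l v) v"
  let ?R = "\<lambda>l v. rand_updates G \<alpha> \<theta> (\<lambda>_. 1) (r (l, v)) (hop_est r l v) v"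
  have *: "\<alpha> * \<theta> * real (card (?D l v) + card (?R l v))
      \<le> (\<Sum>u\<in>pverts G. contribution (r (l, v)) (hop_est r l v) u v)" for l v
  proof -
    have card: "\<alpha> * \<theta> * real (card A) = (\<Sum>u\<in>pverts G. if u \<in> A then \<alpha> * \<theta> else 0)"
      if "A \<subseteq> pverts G" for A
      using that finite_verts by (simp add: sum.If_cases Int_absorb1)
    have "?D l v \<subseteq> pverts G" "?R l v \<subseteq> pverts G"
      using in_nbrs_subset[of v] by (auto simp: det_updates_def rand_updates_def)
    then have "\<alpha> * \<theta> * real (card (?D l v) + card (?R l v))
       = (\<Sum>u\<in>pverts G. (if u \<in> ?D l v then \<alpha> * \<theta> else 0) + (if u \<in> ?R l v then \<alpha> * \<theta> else 0))"
      by (simp add: card distrib_left sum.distrib)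
    also have "\<dots> \<le> (\<Sum>u\<in>pverts G. contribution (r (l, v)) (hop_est r l v) u v)"
    proof (intro sum_mono)
      fix u
      have "\<alpha> * \<theta> \<le> (1 - \<alpha>) * hop_est r l v / d_out G u" if "u \<in> ?D l v"
      proof -
        have "(u, v) \<in> parcs G" "d_out G u \<le> (1 - \<alpha>) * hop_est r l v / (\<alpha> * \<theta>)"
          using that by (auto simp: in_det_updates)
        then show ?thesis using d_out_ge_1[of u v] \<alpha> \<theta> by (simp add: field_simps)
      qed
      then show "(if u \<in> ?D l v then \<alpha> * \<theta> else 0) + (if u \<in> ?R l v then \<alpha> * \<theta> else 0)
         \<le> contribution (r (l, v)) (hop_est r l v) u v"
        by (auto simp: contribution_def)
    qed
    finally show ?thesis .
  qed
  have "\<alpha> * \<theta> * rbs_cost G \<alpha> \<theta> (\<lambda>_. 1) t r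
     = (\<Sum>l<L. \<Sum>v\<in>{v \<in> pverts G. hop_est r l v \<noteq> 0}. \<alpha> * \<theta> * real (card (?D l v) + card (?R l v)))"
    by (simp add: rbs_cost_def sum_distrib_left)
  also have "\<dots> \<le> (\<Sum>l<L. \<Sum>v\<in>pverts G. \<Sum>u\<in>pverts G. contribution (r (l, v)) (hop_est r l v) u v)"
    using finite_verts
    by (intro sum_mono order.trans[OF sum_mono[OF *] sum_mono2])
       (auto intro!: sum_nonneg contribution_nonneg hop_est_nonneg)
  also have "\<dots> = (\<Sum>u\<in>pverts G. \<Sum>l<L. hop_est r (Suc l) u)"
    unfolding hop_est_Suc
    by (subst (2) sum.swap) (intro sum.cong refl sum.swap)
  also have "\<dots> \<le> (\<Sum>u\<in>pverts G. \<Sum>l\<le>L. hop_est r l u)"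
    by (intro sum_mono)
       (simp add: lessThan_Suc_atMost[symmetric] sum.lessThan_Suc_shift hop_est_nonneg
         del: rbs_hop.simps sum.lessThan_Suc)
  finally show ?thesis .
qed

end

subsection \<open>Moments, accuracy and cost\<close>

text \<open>Pythagoras. \<open>A\<close> will be the error inherited from earlier rounds and the
  \<open>F v\<close> the rounding errors of one round.\<close>

lemma (in prob_space) second_moment_orthogonal_sum:
  assumes fin: "finite S" and A: "bounded_rv M A" and F: "\<And>v. v \<in> S \<Longrightarrow> bounded_rv M (F v)"
    and AF: "\<And>v. v \<in> S \<Longrightarrow> (\<integral>\<omega>. A \<omega> * F v \<omega> \<partial>M) = 0"
    and FF: "\<And>v w. v \<in> S \<Longrightarrow> w \<in> S \<Longrightarrow> v \<noteq> w \<Longrightarrow> (\<integral>\<omega>. F v \<omega> * F w \<omega> \<partial>M) = 0"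
  shows "(\<integral>\<omega>. (A \<omega> + (\<Sum>v\<in>S. F v \<omega>))\<^sup>2 \<partial>M)
    = (\<integral>\<omega>. (A \<omega>)\<^sup>2 \<partial>M) + (\<Sum>v\<in>S. (\<integral>\<omega>. (F v \<omega>)\<^sup>2 \<partial>M))"
proof -
  have sq: "(a + (\<Sum>v\<in>S. f v))\<^sup>2 = a\<^sup>2 + 2 * (\<Sum>v\<in>S. a * f v) + (\<Sum>v\<in>S. \<Sum>w\<in>S. f v * f w)"
    for a :: real and f
  proof -
    have "(\<Sum>v\<in>S. f v)\<^sup>2 = (\<Sum>v\<in>S. \<Sum>w\<in>S. f v * f w)"
      by (simp add: power2_eq_square sum_product)
    then show ?thesis by (simp add: power2_sum sum_distrib_left mult.assoc)
  qed
  have int: "integrable M (\<lambda>\<omega>. (A \<omega>)\<^sup>2)" "\<And>v. v \<in> S \<Longrightarrow> integrable M (\<lambda>\<omega>. A \<omega> * F v \<omega>)"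
    "\<And>v w. v \<in> S \<Longrightarrow> w \<in> S \<Longrightarrow> integrable M (\<lambda>\<omega>. F v \<omega> * F w \<omega>)"
    using A F by (auto intro!: bounded_rv_integrable bounded_rv_intros)
  have "(\<integral>\<omega>. (A \<omega> + (\<Sum>v\<in>S. F v \<omega>))\<^sup>2 \<partial>M)
      = (\<integral>\<omega>. (A \<omega>)\<^sup>2 \<partial>M) + 2 * (\<Sum>v\<in>S. (\<integral>\<omega>. A \<omega> * F v \<omega> \<partial>M))
        + (\<Sum>v\<in>S. \<Sum>w\<in>S. (\<integral>\<omega>. F v \<omega> * F w \<omega> \<partial>M))"
    unfolding sq using int by simp
  also have "(\<Sum>v\<in>S. \<Sum>w\<in>S. (\<integral>\<omega>. F v \<omega> * F w \<omega> \<partial>M)) = (\<Sum>v\<in>S. (\<integral>\<omega>. (F v \<omega>)\<^sup>2 \<partial>M))"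
  proof (rule sum.cong[OF refl])
    fix v assume v: "v \<in> S"
    have "(\<Sum>w\<in>S. (\<integral>\<omega>. F v \<omega> * F w \<omega> \<partial>M)) = (\<Sum>w\<in>S. if w = v then (\<integral>\<omega>. F v \<omega> * F v \<omega> \<partial>M) else 0)"
      by (rule sum.cong) (use FF[OF v] in auto)
    then show "(\<Sum>w\<in>S. (\<integral>\<omega>. F v \<omega> * F w \<omega> \<partial>M)) = (\<integral>\<omega>. (F v \<omega>)\<^sup>2 \<partial>M)"
      using v fin by (simp add: power2_eq_square)
  qed
  finally show ?thesis using AF by simp
qed

text \<open>Jensen's inequality for weights of total at most 1, obtained from Cauchy-Schwarz by
  writing each weight as the square of its root.\<close>

lemma square_sum_subconvex_le:
  fixes w x :: "'b \<Rightarrow> real"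
  assumes "\<And>v. v \<in> S \<Longrightarrow> 0 \<le> w v" "(\<Sum>v\<in>S. w v) \<le> 1"
  shows "(\<Sum>v\<in>S. w v * x v)\<^sup>2 \<le> (\<Sum>v\<in>S. w v * (x v)\<^sup>2)"
proof -
  have "(\<Sum>v\<in>S. w v * x v)\<^sup>2 = (\<Sum>v\<in>S. sqrt (w v) * (sqrt (w v) * x v))\<^sup>2"
    using assms by (intro arg_cong[where f="\<lambda>y. y\<^sup>2"] sum.cong) (auto simp flip: mult.assoc)
  also have "\<dots> \<le> (\<Sum>v\<in>S. (sqrt (w v))\<^sup>2) * (\<Sum>v\<in>S. (sqrt (w v) * x v)\<^sup>2)"
    by (rule Cauchy_Schwarz_ineq_sum)
  also have "\<dots> = (\<Sum>v\<in>S. w v) * (\<Sum>v\<in>S. w v * (x v)\<^sup>2)"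
    using assms by (simp add: power_mult_distrib)
  also have "\<dots> \<le> 1 * (\<Sum>v\<in>S. w v * (x v)\<^sup>2)"
    using assms by (intro mult_right_mono sum_nonneg) auto
  finally show ?thesis by simp
qed

lemma borel_measurable_unif01_component:
  "j \<in> J \<Longrightarrow> (\<lambda>\<omega>. \<omega> j) \<in> borel_measurable (PiM J (\<lambda>_. unif01))"
  using measurable_component_singleton[of j J "\<lambda>_. unif01"]
  by (simp add: measurable_cong_sets[OF refl, of unif01 borel])

section \<open>Independent copies: unbiasedness and variance\<close>

locale rbs_copies = rbs_run G \<alpha> t \<theta> for G :: "'a pair_pre_digraph" and \<alpha> t \<theta> +
  fixes k :: nat
begin

abbreviation "coords \<equiv> {..<k} \<times> {..<L} \<times> pverts G"
abbreviation "M \<equiv> PiM coords (\<lambda>_. unif01)"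

lemma rbs_space_eq: "rbs_space G \<alpha> \<theta> k = M"
  by (simp add: rbs_space_def)

sublocale prob_space M
  by (rule prob_space_PiM) (rule prob_space_unif01)

abbreviation copy_hop :: "nat \<Rightarrow> nat \<Rightarrow> 'a \<Rightarrow> (nat \<times> nat \<times> 'a \<Rightarrow> real) \<Rightarrow> real" where
  "copy_hop i l u \<omega> \<equiv> hop_est (\<lambda>x. \<omega> (i, x)) l u"

abbreviation copy_est :: "nat \<Rightarrow> 'a \<Rightarrow> (nat \<times> nat \<times> 'a \<Rightarrow> real) \<Rightarrow> real" where
  "copy_est i s \<omega> \<equiv> rbs_estimate G \<alpha> \<theta> (\<lambda>_. 1) t (\<lambda>x. \<omega> (i, x)) s"

lemma bounded_rv_copy_hop:
  assumes "{i} \<times> {..<l} \<times> pverts G \<subseteq> J"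
  shows "bounded_rv (PiM J (\<lambda>_. unif01)) (copy_hop i l u)"
proof -
  obtain B where "\<And>r u. hop_est r l u \<le> B" using hop_est_bounded by blast
  then show ?thesis using assms
    by (intro bounded_rvI[of _ _ B] borel_measurable_hop_est borel_measurable_unif01_component)
       (auto simp: hop_est_nonneg)
qed

lemma bounded_rv_copy_hop_M: "i < k \<Longrightarrow> l \<le> L \<Longrightarrow> bounded_rv M (copy_hop i l u)"
  by (rule bounded_rv_copy_hop) auto

lemma borel_measurable_copy_est:
  assumes "{i} \<times> {..<L} \<times> pverts G \<subseteq> J"
  shows "copy_est i s \<in> borel_measurable (PiM J (\<lambda>_. unif01))"
  unfolding rbs_estimate_def using assms
  by (intro borel_measurable_sum borel_measurable_hop_est borel_measurable_unif01_component) auto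

lemma borel_measurable_copy_est_M: "i < k \<Longrightarrow> copy_est i s \<in> borel_measurable M"
  by (rule borel_measurable_copy_est) auto

text \<open>Each copy reads only its own block of coordinates; this yields the independence of the
  copies in the median argument.\<close>

lemma copy_est_restrict:
  "copy_est i s (restrict \<omega> ({i} \<times> {..<L} \<times> pverts G)) = copy_est i s \<omega>"
  unfolding rbs_estimate_def by (intro sum.cong refl hop_est_cong) auto

lemma copy_hop_upd: "l \<le> j \<Longrightarrow> copy_hop i' l u (x((i, j, v) := y)) = copy_hop i' l u x"
  by (rule hop_est_cong) auto

text \<open>The rounding error made when \<open>v\<close> updates \<open>u\<close>, measured against
  its mean for the given estimate at \<open>v\<close>. It plays the part of a martingale
  difference.\<close>

definition fluctuation :: "nat \<Rightarrow> nat \<Rightarrow> 'a \<Rightarrow> 'a \<Rightarrow> (nat \<times> nat \<times> 'a \<Rightarrow> real) \<Rightarrow> real" where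
  "fluctuation i l u v \<omega>
     = contribution (\<omega> (i, l, v)) (copy_hop i l v \<omega>) u v - step_weight u v * copy_hop i l v \<omega>"

lemma copy_hop_Suc: "copy_hop i (Suc l) u \<omega>
    = (\<Sum>v\<in>pverts G. step_weight u v * copy_hop i l v \<omega>) + (\<Sum>v\<in>pverts G. fluctuation i l u v \<omega>)"
  unfolding hop_est_Suc by (simp add: fluctuation_def sum_subtractf)

lemma bounded_rv_fluctuation:
  assumes "i < k" "l < L" "v \<in> pverts G"
  shows "bounded_rv M (fluctuation i l u v)"
proof -
  have X: "bounded_rv M (copy_hop i l v)" using assms by (intro bounded_rv_copy_hop_M) auto
  obtain B where B: "\<And>r u. hop_est r l u \<le> B" using hop_est_bounded by blast
  have "bounded_rv M (\<lambda>\<omega>. contribution (\<omega> (i, l, v)) (copy_hop i l v \<omega>) u v)"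
  proof (rule bounded_rvI)
    show "(\<lambda>\<omega>. contribution (\<omega> (i, l, v)) (copy_hop i l v \<omega>) u v) \<in> borel_measurable M"
      using assms X
      by (intro borel_measurable_contribution borel_measurable_unif01_component)
         (auto simp: bounded_rv_def)
    show "\<bar>contribution (\<omega> (i, l, v)) (copy_hop i l v \<omega>) u v\<bar> \<le> B + \<alpha> * \<theta>" for \<omega>
      using contribution_nonneg[OF hop_est_nonneg] contribution_le[OF hop_est_nonneg] B
      by (smt (verit))
  qed
  then show ?thesis
    unfolding fluctuation_def using X by (intro bounded_rv_intros)
qed

text \<open>Resampling the draw of \<open>(i, l, v)\<close> leaves the level \<open>l\<close>
  estimate at \<open>v\<close> fixed, so only the rounding varies, and that is unbiased for any
  fixed estimate.\<close>

lemma fluctuation_centred: "(\<integral>y. fluctuation i l u v (x((i, l, v) := y)) \<partial>unif01) = 0"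
proof -
  interpret U: prob_space unif01 by (rule prob_space_unif01)
  let ?X = "copy_hop i l v x"
  have "bounded_rv unif01 (\<lambda>y. contribution y ?X u v)"
    using contribution_nonneg[OF hop_est_nonneg] contribution_le[OF hop_est_nonneg]
    by (intro bounded_rvI[of _ _ "?X + \<alpha> * \<theta>"] borel_measurable_contribution) auto
  from U.bounded_rv_integrable[OF this] show ?thesis
    unfolding fluctuation_def copy_hop_upd[OF order.refl] fun_upd_same
    by (simp add: integral_contribution hop_est_nonneg U.prob_space)
qed

text \<open>Different nodes of one round use different draws, so one fluctuation can serve as the
  factor \<open>g\<close> against another, centred one.\<close>

lemma fluctuation_upd:
  assumes "v \<noteq> w"
  shows "fluctuation i l u v (x((i, l, w) := y)) = fluctuation i l u v x"
  using assms unfolding fluctuation_def copy_hop_upd[OF order.refl] by simp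

lemma integral_mult_fluctuation:
  assumes "i < k" "l < L" "v \<in> pverts G" "bounded_rv M g" "\<And>x y. g (x((i, l, v) := y)) = g x"
  shows "(\<integral>\<omega>. g \<omega> * fluctuation i l u v \<omega> \<partial>M) = 0"
  using assms
  by (intro integral_PiM_mult_centred_eq_0[where i="(i, l, v)"] bounded_rv_fluctuation
      prob_space_unif01 fluctuation_centred) auto

lemma expectation_copy_hop:
  assumes i: "i < k" and l: "l \<le> L"
  shows "expectation (copy_hop i l u) = hop_ppr l u"
  using l
proof (induction l arbitrary: u)
  case 0
  show ?case by (simp add: prob_space)
next
  case (Suc l)
  have int: "integrable M (copy_hop i l v)" "v \<in> pverts G \<Longrightarrow> integrable M (fluctuation i l u v)" for v
    using i Suc.prems
    by (auto intro!: bounded_rv_integrable bounded_rv_copy_hop_M bounded_rv_fluctuation)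
  have "expectation (fluctuation i l u v) = 0" if "v \<in> pverts G" for v
    using integral_mult_fluctuation[of i l v "\<lambda>_. 1" u] i Suc.prems that by (simp add: bounded_rv_const)
  then show ?case
    unfolding copy_hop_Suc using int Suc by (simp del: rbs_hop.simps)
qed

text \<open>The variance of one rounding is bounded linearly in the current estimate, so
  unbiasedness at level \<open>l\<close> turns this into a bound by the true hop value.\<close>

lemma expectation_fluctuation_square:
  assumes i: "i < k" and l: "l < L" and v: "v \<in> pverts G"
  shows "(\<integral>\<omega>. (fluctuation i l u v \<omega>)\<^sup>2 \<partial>M) \<le> \<alpha> * \<theta> * (step_weight u v * hop_ppr l v)"
proof -
  have X: "bounded_rv M (copy_hop i l v)" using i l by (intro bounded_rv_copy_hop_M) auto
  let ?h = "\<lambda>x. \<integral>y. (fluctuation i l u v (x((i, l, v) := y)))\<^sup>2 \<partial>unif01"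
  have "(\<integral>\<omega>. (fluctuation i l u v \<omega>)\<^sup>2 \<partial>M) = (\<integral>x. ?h x \<partial>M)"
    using i l v
    by (intro integral_PiM_resample bounded_rv_power2 bounded_rv_fluctuation prob_space_unif01) auto
  also have "\<dots> \<le> (\<integral>x. \<alpha> * \<theta> * (step_weight u v * copy_hop i l v x) \<partial>M)"
  \<comment> \<open>This monotonicity rule asks for an integrable nonnegative majorant, which spares
    a separate treatment of the inner integral \<open>?h\<close>.\<close>
  proof (rule integral_mono_AE')
    show "integrable M (\<lambda>x. \<alpha> * \<theta> * (step_weight u v * copy_hop i l v x))"
      using X by (intro bounded_rv_integrable bounded_rv_intros)
    show "AE x in M. ?h x \<le> \<alpha> * \<theta> * (step_weight u v * copy_hop i l v x)"
      unfolding fluctuation_def copy_hop_upd[OF order.refl] fun_upd_same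
      by (intro AE_I2 variance_contribution hop_est_nonneg)
    show "AE x in M. 0 \<le> \<alpha> * \<theta> * (step_weight u v * copy_hop i l v x)"
      using \<alpha> \<theta> by (intro AE_I2 mult_nonneg_nonneg step_weight_nonneg hop_est_nonneg) auto
  qed
  also have "\<dots> = \<alpha> * \<theta> * (step_weight u v * hop_ppr l v)"
    using i l by (simp add: expectation_copy_hop)
  finally show ?thesis .
qed

text \<open>A bound proportional to the hop value is preserved by the step matrix: inherited errors
  keep the factor \<open>l\<close>, and the new round adds one further unit
  \<open>\<alpha> * \<theta> * hop_ppr (Suc l) u\<close>.\<close>

lemma variance_copy_hop:
  assumes i: "i < k" and l: "l \<le> L"
  shows "(\<integral>\<omega>. (copy_hop i l u \<omega> - hop_ppr l u)\<^sup>2 \<partial>M) \<le> real l * (\<alpha> * \<theta> * hop_ppr l u)"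
  using l
proof (induction l arbitrary: u)
  case 0
  show ?case by simp
next
  case (Suc l)
  then have l: "l < L" by simp
  define D where "D v \<omega> = copy_hop i l v \<omega> - hop_ppr l v" for v \<omega>
  define A where "A \<omega> = (\<Sum>v\<in>pverts G. step_weight u v * D v \<omega>)" for \<omega>
  have D: "bounded_rv M (D v)" for v
    unfolding D_def using i l by (intro bounded_rv_intros bounded_rv_copy_hop_M) auto
  have A: "bounded_rv M A"
    unfolding A_def using D by (intro bounded_rv_intros)
  have F: "bounded_rv M (fluctuation i l u v)" if "v \<in> pverts G" for v
    by (rule bounded_rv_fluctuation) fact+
  have A_upd: "A (x((i, l, v) := y)) = A x" for x v y
    unfolding A_def D_def copy_hop_upd[OF order.refl] ..
  have "copy_hop i (Suc l) u \<omega> - hop_ppr (Suc l) u = A \<omega> + (\<Sum>v\<in>pverts G. fluctuation i l u v \<omega>)" for \<omega>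
    unfolding copy_hop_Suc by (simp add: A_def D_def right_diff_distrib sum_subtractf)
  then have "(\<integral>\<omega>. (copy_hop i (Suc l) u \<omega> - hop_ppr (Suc l) u)\<^sup>2 \<partial>M)
      = (\<integral>\<omega>. (A \<omega> + (\<Sum>v\<in>pverts G. fluctuation i l u v \<omega>))\<^sup>2 \<partial>M)"
    by (simp del: rbs_hop.simps hop_ppr.simps)
  \<comment> \<open>\<open>A\<close> reads only rounds before \<open>l\<close> and is therefore
    orthogonal to every fluctuation of round \<open>l\<close>; distinct fluctuations are orthogonal
    to each other.\<close>
  also have "\<dots> = (\<integral>\<omega>. (A \<omega>)\<^sup>2 \<partial>M) + (\<Sum>v\<in>pverts G. (\<integral>\<omega>. (fluctuation i l u v \<omega>)\<^sup>2 \<partial>M))"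
    using i l
    by (intro second_moment_orthogonal_sum finite_verts A F integral_mult_fluctuation)
       (auto simp: A_upd fluctuation_upd)
  also have "(\<Sum>v\<in>pverts G. (\<integral>\<omega>. (fluctuation i l u v \<omega>)\<^sup>2 \<partial>M))
      \<le> (\<Sum>v\<in>pverts G. \<alpha> * \<theta> * (step_weight u v * hop_ppr l v))"
    using i l by (intro sum_mono expectation_fluctuation_square)
  \<comment> \<open>Estimates at different nodes are correlated; convexity removes their covariances
    at no cost, since the rows of the step matrix sum to at most 1.\<close>
  also have "(\<integral>\<omega>. (A \<omega>)\<^sup>2 \<partial>M) \<le> (\<integral>\<omega>. (\<Sum>v\<in>pverts G. step_weight u v * (D v \<omega>)\<^sup>2) \<partial>M)"
    unfolding A_def using D \<alpha> sum_step_weight_le[of u]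
    by (intro integral_mono bounded_rv_integrable bounded_rv_intros square_sum_subconvex_le
        step_weight_nonneg) auto
  also have "\<dots> = (\<Sum>v\<in>pverts G. step_weight u v * (\<integral>\<omega>. (D v \<omega>)\<^sup>2 \<partial>M))"
    using D by (simp add: bounded_rv_integrable bounded_rv_power2)
  also have "\<dots> \<le> (\<Sum>v\<in>pverts G. step_weight u v * (real l * (\<alpha> * \<theta> * hop_ppr l v)))"
    unfolding D_def using Suc.IH l by (intro sum_mono mult_left_mono step_weight_nonneg) auto
  also have "(\<Sum>v\<in>pverts G. step_weight u v * (real l * (\<alpha> * \<theta> * hop_ppr l v)))
      + (\<Sum>v\<in>pverts G. \<alpha> * \<theta> * (step_weight u v * hop_ppr l v))
      = real (Suc l) * (\<alpha> * \<theta> * hop_ppr (Suc l) u)"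
    by (simp add: sum_distrib_left sum.distrib[symmetric] algebra_simps)
  finally show ?case by simp
qed

text \<open>Levels may be correlated, so the square of the sum is bounded by \<open>L + 1\<close>
  times the sum of squares; the second factor \<open>L + 1\<close> replaces the level number in
  \<open>variance_copy_hop\<close>.\<close>

lemma variance_copy_est:
  assumes i: "i < k"
  shows "(\<integral>\<omega>. (copy_est i s \<omega> - (\<Sum>l\<le>L. hop_ppr l s))\<^sup>2 \<partial>M)
    \<le> (real L + 1)\<^sup>2 * (\<alpha> * \<theta> * ppr G \<alpha> s t)"
proof -
  let ?D = "\<lambda>l \<omega>. copy_hop i l s \<omega> - hop_ppr l s"
  have D: "bounded_rv M (?D l)" if "l \<le> L" for l
    using i that by (intro bounded_rv_intros bounded_rv_copy_hop_M)
  have "(\<integral>\<omega>. (copy_est i s \<omega> - (\<Sum>l\<le>L. hop_ppr l s))\<^sup>2 \<partial>M) = (\<integral>\<omega>. (\<Sum>l\<le>L. ?D l \<omega>)\<^sup>2 \<partial>M)"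
    by (simp add: rbs_estimate_def sum_subtractf)
  also have "\<dots> \<le> (\<integral>\<omega>. (\<Sum>l\<le>L. (?D l \<omega>)\<^sup>2) * (real L + 1) \<partial>M)"
    using D sum_squared_le_sum_of_squares[of "\<lambda>l. ?D l _" "{..L}"]
    by (intro integral_mono bounded_rv_integrable bounded_rv_intros) 
      (auto simp: add.commute intro!: bounded_rv_copy_hop_M[OF i])
  also have "\<dots> = (real L + 1) * (\<Sum>l\<le>L. (\<integral>\<omega>. (?D l \<omega>)\<^sup>2 \<partial>M))"
    using D by (simp add: bounded_rv_integrable bounded_rv_power2)
  also have "\<dots> \<le> (real L + 1) * (\<Sum>l\<le>L. (real L + 1) * (\<alpha> * \<theta> * hop_ppr l s))"
  proof (intro mult_left_mono sum_mono)
    fix l assume "l \<in> {..L}"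
    then have "(\<integral>\<omega>. (?D l \<omega>)\<^sup>2 \<partial>M) \<le> real l * (\<alpha> * \<theta> * hop_ppr l s)"
      using i by (intro variance_copy_hop) auto
    also have "\<dots> \<le> (real L + 1) * (\<alpha> * \<theta> * hop_ppr l s)"
      using \<open>l \<in> {..L}\<close> \<alpha> \<theta> hop_ppr_nonneg[of l s] by (intro mult_right_mono) auto
    finally show "(\<integral>\<omega>. (?D l \<omega>)\<^sup>2 \<partial>M) \<le> (real L + 1) * (\<alpha> * \<theta> * hop_ppr l s)" .
  qed auto
  also have "\<dots> = (real L + 1)\<^sup>2 * (\<alpha> * \<theta> * (\<Sum>l\<le>L. hop_ppr l s))"
    by (simp add: sum_distrib_left power2_eq_square mult.assoc)
  also have "\<dots> \<le> (real L + 1)\<^sup>2 * (\<alpha> * \<theta> * ppr G \<alpha> s t)"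
    using sum_hop_ppr_le[of s "Suc L"] \<alpha> \<theta> by (intro mult_left_mono) (auto simp: lessThan_Suc_atMost)
  finally show ?thesis .
qed

text \<open>The tolerance of one tenth is halved: truncation takes at most one twentieth of the
  value, because the bias is at most \<theta>, and Chebyshev handles the other twentieth. The factor
  400 is the square of 20.\<close>

lemma prob_copy_est_deviation:
  assumes i: "i < k" and p: "20 * \<theta> \<le> ppr G \<alpha> s t"
  shows "prob {\<omega> \<in> space M. \<bar>copy_est i s \<omega> - ppr G \<alpha> s t\<bar> > 1 / 10 * ppr G \<alpha> s t}
    \<le> 400 * (real L + 1)\<^sup>2 * \<alpha> * \<theta> / ppr G \<alpha> s t"
proof -
  let ?p = "ppr G \<alpha> s t" and ?m = "\<Sum>l\<le>L. hop_ppr l s"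
  have p0: "0 < ?p" using p \<theta> by linarith
  have bias: "\<bar>?m - ?p\<bar> \<le> ?p / 20"
    using ppr_minus_hops[of s "Suc L"] depth_power_le[OF \<alpha> \<theta>] p
    by (simp only: lessThan_Suc_atMost) linarith
  have dev: "(?p / 20)\<^sup>2 \<le> (copy_est i s \<omega> - ?m)\<^sup>2"
    if "\<bar>copy_est i s \<omega> - ?p\<bar> > 1 / 10 * ?p" for \<omega>
    using that bias p0 by (intro abs_le_square_iff[THEN iffD1]) linarith
  have [measurable]: "copy_est i s \<in> borel_measurable M"
    by (rule borel_measurable_copy_est_M[OF i])
  have "bounded_rv M (\<lambda>\<omega>. (copy_est i s \<omega> - ?m)\<^sup>2)"
    unfolding rbs_estimate_def using i
    by (intro bounded_rv_intros bounded_rv_copy_hop_M) auto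
  then have int: "integrable M (\<lambda>\<omega>. (copy_est i s \<omega> - ?m)\<^sup>2)" by (rule bounded_rv_integrable)
  have "prob {\<omega> \<in> space M. \<bar>copy_est i s \<omega> - ?p\<bar> > 1 / 10 * ?p}
      \<le> prob {\<omega> \<in> space M. (copy_est i s \<omega> - ?m)\<^sup>2 \<ge> (?p / 20)\<^sup>2}"
    by (rule finite_measure_mono) (auto intro: dev)
  also have "\<dots> \<le> (\<integral>\<omega>. (copy_est i s \<omega> - ?m)\<^sup>2 \<partial>M) / (?p / 20)\<^sup>2"
    using p0 by (intro integral_Markov_inequality_measure[OF int, of "{}"]) auto
  also have "\<dots> \<le> (real L + 1)\<^sup>2 * (\<alpha> * \<theta> * ?p) / (?p / 20)\<^sup>2"
    by (intro divide_right_mono variance_copy_est i) auto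
  also have "\<dots> = 400 * (real L + 1)\<^sup>2 * \<alpha> * \<theta> / ?p"
    using p0 by (simp add: power2_eq_square field_simps)
  finally show ?thesis .
qed

section \<open>Amplification by the median\<close>

lemma borel_measurable_rbs_median:
  assumes "0 < k"
  shows "(\<lambda>\<omega>. rbs_median G \<alpha> \<theta> (\<lambda>_. 1) k t \<omega> s) \<in> borel_measurable M"
  unfolding rbs_median_def
  by (intro borel_measurable_median borel_measurable_copy_est_M assms)

text \<open>Chernoff-style: if the median is off, at least half of the copies are, so that
  \<open>\<Prod>i<k. (1 + 15 * [copy i is off]) \<ge> 16 ^ (k/2)\<close>; the factors are independent with mean at
  most \<open>1 + 15/64\<close>.\<close>

lemma prob_median_deviation:
  assumes k: "0 < k"
    and bad: "\<And>i. i < k \<Longrightarrow> prob {\<omega> \<in> space M. \<bar>copy_est i s \<omega> - m\<bar> > e} \<le> 1 / 64"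
  shows "prob {\<omega> \<in> space M. \<bar>rbs_median G \<alpha> \<theta> (\<lambda>_. 1) k t \<omega> s - m\<bar> > e} \<le> exp (- real k)"
proof -
  define g :: "nat \<Rightarrow> (nat \<times> nat \<times> 'a \<Rightarrow> real) \<Rightarrow> real"
    where "g i \<omega> = 1 + 15 * indicator {\<omega>. \<bar>copy_est i s \<omega> - m\<bar> > e} \<omega>"
    for i \<omega>
  let ?K = "\<lambda>i::nat. {i} \<times> {..<L} \<times> pverts G"
  have g_bounded: "bounded_rv (PiM J (\<lambda>_. unif01)) (g i)" if "?K i \<subseteq> J" for i J
  proof (rule bounded_rvI)
    have [measurable]: "copy_est i s \<in> borel_measurable (PiM J (\<lambda>_. unif01))"
      by (rule borel_measurable_copy_est[OF that])
    show "g i \<in> borel_measurable (PiM J (\<lambda>_. unif01))"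
      unfolding g_def indicator_def mem_Collect_eq by measurable
    show "\<bar>g i \<omega>\<bar> \<le> 16" for \<omega> by (simp add: g_def indicator_def)
  qed
  have g_restrict: "g i (restrict \<omega> (?K i)) = g i \<omega>" for i \<omega>
    unfolding g_def indicator_def mem_Collect_eq copy_est_restrict ..
  have "prob_space unif01" by (rule prob_space_unif01)
  then have "(\<integral>\<omega>. (\<Prod>i<k. g i \<omega>) \<partial>M) = (\<Prod>i<k. (\<integral>\<omega>. g i \<omega> \<partial>M))"
    using g_bounded g_restrict
    by (intro integral_PiM_prod_blocks[where K="?K"]) (auto simp: disjoint_family_on_def)
  also have "\<dots> \<le> (\<Prod>i<k. 79 / 64)"
  proof (rule prod_mono, safe)
    fix i assume "i < k"
    have [measurable]: "copy_est i s \<in> borel_measurable M"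
      by (rule borel_measurable_copy_est_M[OF \<open>i < k\<close>])
    have "(\<integral>\<omega>. g i \<omega> \<partial>M)
        = (\<integral>\<omega>. 1 + 15 * indicator {\<omega> \<in> space M. \<bar>copy_est i s \<omega> - m\<bar> > e} \<omega> \<partial>M)"
      by (rule Bochner_Integration.integral_cong) (auto simp: g_def indicator_def)
    also have "\<dots> = 1 + 15 * prob {\<omega> \<in> space M. \<bar>copy_est i s \<omega> - m\<bar> > e}"
      by (subst Bochner_Integration.integral_add) (auto simp: prob_space less_top[symmetric])
    finally show "(\<integral>\<omega>. g i \<omega> \<partial>M) \<le> 79 / 64" "0 \<le> (\<integral>\<omega>. g i \<omega> \<partial>M)"
      using bad[OF \<open>i < k\<close>] by auto
  qed
  finally have E: "(\<integral>\<omega>. (\<Prod>i<k. g i \<omega>) \<partial>M) \<le> (79 / 64) ^ k" by simp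
  have g1: "1 \<le> g i \<omega>" for i \<omega> by (simp add: g_def indicator_def)
  have prod_bounded: "bounded_rv M (\<lambda>\<omega>. \<Prod>i\<in>A. g i \<omega>)" if "A \<subseteq> {..<k}" "finite A" for A
    using that(2,1)
    by (induction A rule: finite_induct) (auto intro!: bounded_rv_intros g_bounded)
  have many: "4 ^ k \<le> (\<Prod>i<k. g i \<omega>)"
    if "\<bar>rbs_median G \<alpha> \<theta> (\<lambda>_. 1) k t \<omega> s - m\<bar> > e" for \<omega>
  proof -
    let ?B = "{i \<in> {..<k}. \<bar>copy_est i s \<omega> - m\<bar> > e}"
    have "length (filter (\<lambda>x. \<bar>x - m\<bar> > e) (map (\<lambda>i. copy_est i s \<omega>) [0..<k])) = card ?B"
      by (auto simp: length_filter_conv_card intro!: arg_cong[where f=card])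
    then have "k \<le> 2 * card ?B"
      using median_deviation_le[of e m "map (\<lambda>i. copy_est i s \<omega>) [0..<k]"] that
      by (auto simp: rbs_median_def not_less[symmetric])
    then have "(4::real) ^ k \<le> 4 ^ (2 * card ?B)" by (intro power_increasing) auto
    also have "\<dots> = (\<Prod>i\<in>?B. 16)" by (simp add: power_mult)
    also have "\<dots> = (\<Prod>i<k. g i \<omega>)"
      by (subst prod.mono_neutral_cong_right[of "{..<k}" ?B _ "\<lambda>_. 16"]) (auto simp: g_def)
    finally show ?thesis .
  qed
  have P: "bounded_rv M (\<lambda>\<omega>. \<Prod>i<k. g i \<omega>)" by (rule prod_bounded) auto
  then have [measurable]: "(\<lambda>\<omega>. \<Prod>i<k. g i \<omega>) \<in> borel_measurable M" by (simp add: bounded_rv_def)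
  have "prob {\<omega> \<in> space M. \<bar>rbs_median G \<alpha> \<theta> (\<lambda>_. 1) k t \<omega> s - m\<bar> > e}
      \<le> prob {\<omega> \<in> space M. (\<Prod>i<k. g i \<omega>) \<ge> 4 ^ k}"
    by (rule finite_measure_mono) (auto intro: many)
  also have "\<dots> \<le> (\<integral>\<omega>. (\<Prod>i<k. g i \<omega>) \<partial>M) / 4 ^ k"
    using g1 by (intro integral_Markov_inequality_measure[OF bounded_rv_integrable[OF P], of "{}"])
      (auto intro!: AE_I2 prod_nonneg intro: order.trans[OF zero_le_one])
  also have "\<dots> \<le> (79 / 64) ^ k / 4 ^ k" by (intro divide_right_mono E) auto
  also have "\<dots> = (79 / 256) ^ k" by (simp add: power_divide[symmetric])
  \<comment> \<open>From \<open>exp 1 \<le> 3\<close> the inverse is at least 1/3, which exceeds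
    79/256.\<close>
  also have "\<dots> \<le> exp (- 1) ^ k"
    using exp_le by (intro power_mono) (auto simp: exp_minus field_simps)
  also have "\<dots> = exp (- real k)" by (simp add: exp_of_nat_mult[symmetric])
  finally show ?thesis .
qed

text \<open>Union bound over the nodes above the threshold. There the failure bound of a single copy
  divides by a value larger than \<delta>, so the last assumption brings it down to 1/64.\<close>

lemma prob_all_medians_close:
  assumes k: "0 < k" and \<delta>: "20 * \<theta> \<le> \<delta>" "400 * (real L + 1)\<^sup>2 * \<alpha> * \<theta> \<le> \<delta> / 64"
  shows "prob {\<omega> \<in> space M. \<forall>s\<in>pverts G. ppr G \<alpha> s t > \<delta> \<longrightarrow>
      \<bar>rbs_median G \<alpha> \<theta> (\<lambda>_. 1) k t \<omega> s - ppr G \<alpha> s t\<bar> \<le> 1 / 10 * ppr G \<alpha> s t}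
    \<ge> 1 - real (card (pverts G)) * exp (- real k)"
proof -
  let ?S = "{s \<in> pverts G. ppr G \<alpha> s t > \<delta>}"
  let ?bad = "\<lambda>s. {\<omega> \<in> space M.
    \<bar>rbs_median G \<alpha> \<theta> (\<lambda>_. 1) k t \<omega> s - ppr G \<alpha> s t\<bar> > 1 / 10 * ppr G \<alpha> s t}"
  note [measurable] = borel_measurable_rbs_median[OF k]
  have fin: "finite ?S" using finite_verts by simp
  have bad: "prob (?bad s) \<le> exp (- real k)" if "s \<in> ?S" for s
  proof (rule prob_median_deviation[OF k])
    fix i assume "i < k"
    have p: "\<delta> < ppr G \<alpha> s t" "0 < \<delta>" using that \<delta> \<theta> by auto
    have "prob {\<omega> \<in> space M. \<bar>copy_est i s \<omega> - ppr G \<alpha> s t\<bar> > 1 / 10 * ppr G \<alpha> s t}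
        \<le> 400 * (real L + 1)\<^sup>2 * \<alpha> * \<theta> / ppr G \<alpha> s t"
      using p \<delta> by (intro prob_copy_est_deviation \<open>i < k\<close>) auto
    also have "\<dots> \<le> (\<delta> / 64) / ppr G \<alpha> s t" using p \<delta> by (intro divide_right_mono) auto
    also have "\<dots> \<le> 1 / 64" using p by (simp add: field_simps)
    finally show "prob {\<omega> \<in> space M. \<bar>copy_est i s \<omega> - ppr G \<alpha> s t\<bar> > 1 / 10 * ppr G \<alpha> s t} \<le> 1 / 64" .
  qed
  have "prob (\<Union>s\<in>?S. ?bad s) \<le> (\<Sum>s\<in>?S. prob (?bad s))"
    by (rule finite_measure_subadditive_finite[OF fin]) auto
  also have "\<dots> \<le> (\<Sum>s\<in>?S. exp (- real k))" by (intro sum_mono bad)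
  also have "\<dots> \<le> real (card (pverts G)) * exp (- real k)"
    using finite_verts by (auto intro!: mult_right_mono card_mono)
  finally have "prob (\<Union>s\<in>?S. ?bad s) \<le> real (card (pverts G)) * exp (- real k)" .
  moreover have "{\<omega> \<in> space M. \<forall>s\<in>pverts G. ppr G \<alpha> s t > \<delta> \<longrightarrow>
      \<bar>rbs_median G \<alpha> \<theta> (\<lambda>_. 1) k t \<omega> s - ppr G \<alpha> s t\<bar> \<le> 1 / 10 * ppr G \<alpha> s t}
      = space M - (\<Union>s\<in>?S. ?bad s)"
    by (auto simp: not_le)
  moreover have "(\<Union>s\<in>?S. ?bad s) \<in> events"
    using fin by (intro sets.finite_UN) auto
  ultimately show ?thesis by (simp add: prob_compl)
qed

section \<open>Expected cost\<close>

lemma expected_total_cost_le: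
  "(\<integral>\<^sup>+\<omega>. of_nat (rbs_total_cost G \<alpha> \<theta> (\<lambda>_. 1) k t \<omega>) \<partial>M)
    \<le> ennreal (real k * (real (card (pverts G)) * pagerank G \<alpha> t) / (\<alpha> * \<theta>))"
proof -
  let ?f = "\<lambda>\<omega>. (\<Sum>i<k. \<Sum>u\<in>pverts G. \<Sum>l\<le>L. copy_hop i l u \<omega>) / (\<alpha> * \<theta>)"
  have \<alpha>\<theta>: "0 < \<alpha> * \<theta>" using \<alpha> \<theta> by simp
  have cost: "real (rbs_total_cost G \<alpha> \<theta> (\<lambda>_. 1) k t \<omega>) \<le> ?f \<omega>" for \<omega>
  proof -
    have "\<alpha> * \<theta> * real (rbs_total_cost G \<alpha> \<theta> (\<lambda>_. 1) k t \<omega>)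
        \<le> (\<Sum>i<k. \<Sum>u\<in>pverts G. \<Sum>l\<le>L. copy_hop i l u \<omega>)"
      unfolding rbs_total_cost_def of_nat_sum sum_distrib_left by (intro sum_mono rbs_cost_le)
    then show ?thesis using \<alpha>\<theta> by (simp add: field_simps)
  qed
  \<comment> \<open>The cost itself is only bounded pointwise; the expectation is evaluated for the
    majorant, a linear combination of the unbiased estimates.\<close>
  have "(\<integral>\<^sup>+\<omega>. of_nat (rbs_total_cost G \<alpha> \<theta> (\<lambda>_. 1) k t \<omega>) \<partial>M) \<le> (\<integral>\<^sup>+\<omega>. ennreal (?f \<omega>) \<partial>M)"
    by (intro nn_integral_mono) (simp add: ennreal_of_nat_eq_real_of_nat ennreal_leI cost)
  also have "\<dots> = ennreal (\<integral>\<omega>. ?f \<omega> \<partial>M)"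
  proof (rule nn_integral_eq_integral)
    have "bounded_rv M (\<lambda>\<omega>. (\<Sum>i<k. \<Sum>u\<in>pverts G. \<Sum>l\<le>L. copy_hop i l u \<omega>) * (1 / (\<alpha> * \<theta>)))"
      by (intro bounded_rv_intros bounded_rv_copy_hop_M) auto
    then show "integrable M ?f" by (auto dest: bounded_rv_integrable)
    show "AE \<omega> in M. 0 \<le> ?f \<omega>"
      using \<alpha>\<theta> by (intro AE_I2 divide_nonneg_pos sum_nonneg hop_est_nonneg) auto
  qed
  also have "(\<integral>\<omega>. ?f \<omega> \<partial>M) = (\<Sum>i<k. \<Sum>u\<in>pverts G. \<Sum>l\<le>L. hop_ppr l u) / (\<alpha> * \<theta>)"
  proof -
    have int: "integrable M (copy_hop i l u)" if "i \<in> {..<k}" "l \<in> {..L}" for i l u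
      using that by (auto intro!: bounded_rv_integrable bounded_rv_copy_hop_M)
    have "(\<integral>\<omega>. (\<Sum>i<k. \<Sum>u\<in>pverts G. \<Sum>l\<le>L. copy_hop i l u \<omega>) \<partial>M)
        = (\<Sum>i<k. (\<integral>\<omega>. (\<Sum>u\<in>pverts G. \<Sum>l\<le>L. copy_hop i l u \<omega>) \<partial>M))"
      by (intro Bochner_Integration.integral_sum Bochner_Integration.integrable_sum int)
    also have "\<dots> = (\<Sum>i<k. \<Sum>u\<in>pverts G. (\<integral>\<omega>. (\<Sum>l\<le>L. copy_hop i l u \<omega>) \<partial>M))"
      by (intro sum.cong refl Bochner_Integration.integral_sum Bochner_Integration.integrable_sum int)
    also have "\<dots> = (\<Sum>i<k. \<Sum>u\<in>pverts G. \<Sum>l\<le>L. hop_ppr l u)"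
    proof (intro sum.cong refl)
      fix i u assume i: "i \<in> {..<k}"
      have "(\<integral>\<omega>. (\<Sum>l\<le>L. copy_hop i l u \<omega>) \<partial>M) = (\<Sum>l\<le>L. (\<integral>\<omega>. copy_hop i l u \<omega> \<partial>M))"
        by (intro Bochner_Integration.integral_sum int i)
      then show "(\<integral>\<omega>. (\<Sum>l\<le>L. copy_hop i l u \<omega>) \<partial>M) = (\<Sum>l\<le>L. hop_ppr l u)"
        using i by (simp add: expectation_copy_hop)
    qed
    finally show ?thesis by simp
  qed
  also have "\<dots> \<le> (\<Sum>i<k. \<Sum>u\<in>pverts G. ppr G \<alpha> u t) / (\<alpha> * \<theta>)"
    using \<alpha>\<theta> sum_hop_ppr_le[of _ "Suc L"]
    by (intro divide_right_mono sum_mono) (auto simp: lessThan_Suc_atMost)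
  also have "\<dots> = real k * (real (card (pverts G)) * pagerank G \<alpha> t) / (\<alpha> * \<theta>)"
    using t finite_verts by (auto simp: pagerank_def card_eq_0_iff)
  finally show ?thesis by (simp add: ennreal_leI)
qed

end

subsection \<open>Choice of the parameters\<close>

text \<open>After exchanging the sums, each start node contributes at most 1, with a loss when walks
  vanish at nodes without out-neighbours. Any node can serve as the fixed target of the
  locale.\<close>

lemma sum_pagerank_le_1:
  assumes G: "pair_fin_digraph G" "pverts G \<noteq> {}" and \<alpha>: "0 < \<alpha>" "\<alpha> < 1"
  shows "(\<Sum>t\<in>pverts G. pagerank G \<alpha> t) \<le> 1"
proof -
  obtain t where "t \<in> pverts G" using G by blast
  then interpret walk_graph G \<alpha> t using G \<alpha> by (intro walk_graph.intro)
  have "(\<Sum>t\<in>pverts G. \<Sum>s\<in>pverts G. ppr G \<alpha> s t) = (\<Sum>s\<in>pverts G. \<Sum>t\<in>pverts G. ppr G \<alpha> s t)"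
    by (rule sum.swap)
  also have "\<dots> \<le> (\<Sum>s\<in>pverts G. 1)"
    by (intro sum_mono sum_ppr_le_1)
  finally show ?thesis
    by (auto simp: pagerank_def divide_le_eq_1 simp flip: sum_divide_distrib)
qed

lemma pagerank_nonneg: "0 \<le> pagerank G \<alpha> t"
  by (simp add: pagerank_def ppr_def sum_nonneg)

text \<open>The choice of \<open>K\<close> is circular: \<theta> has \<open>K\<close> in its
  denominator, so the depth bound contains \<open>ln K\<close>. A solution exists because a squared
  logarithm grows slower than linearly. The constant 25600 is 400 times 64, from Chebyshev and the
  failure probability of one copy.\<close>

lemma ex_accuracy_constant:
  assumes "0 < (a::real)"
  shows "\<exists>K\<ge>20. 25600 * ((3 + ln K) / a + 1)\<^sup>2 \<le> K"
proof -
  have "eventually (\<lambda>K. 25600 * ((3 + ln K) / a + 1)\<^sup>2 \<le> K) at_top"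
    using assms by real_asymp
  then have "eventually (\<lambda>K. 20 \<le> K \<and> 25600 * ((3 + ln K) / a + 1)\<^sup>2 \<le> K) at_top"
    by (intro eventually_conj eventually_ge_at_top)
  then show ?thesis
    by (auto dest!: eventually_happens)
qed

text \<open>The depth is at most of the order of \<open>1 + ln (1 / \<delta>)\<close>. The square of
  this quantity in the denominator of \<theta> cancels the squared depth in the variance bound and
  leaves a condition on \<open>K\<close> alone.\<close>

lemma accuracy_of_threshold:
  assumes \<alpha>: "0 < \<alpha>" "\<alpha> < 1" and \<delta>: "0 < \<delta>" "\<delta> < 1" and K: "20 \<le> K"
    "25600 * ((3 + ln K) / ln (1 / (1 - \<alpha>)) + 1)\<^sup>2 \<le> K"
    and \<theta>: "\<theta> = \<delta> / (K * (1 + ln (1 / \<delta>))\<^sup>2)"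
  shows "0 < \<theta>" "\<theta> < 1" "20 * \<theta> \<le> \<delta>"
    "400 * (real (rbs_depth \<alpha> \<theta>) + 1)\<^sup>2 * \<alpha> * \<theta> \<le> \<delta> / 64"
proof -
  define lam where "lam = 1 + ln (1 / \<delta>)"
  define a where "a = ln (1 / (1 - \<alpha>))"
  define b where "b = (3 + ln K) / a + 1"
  have lam: "1 \<le> lam" using \<delta> by (simp add: lam_def)
  have a: "0 < a" using \<alpha> by (simp add: a_def)
  have \<theta>_eq: "\<theta> = \<delta> / (K * lam\<^sup>2)" by (simp add: \<theta> lam_def)
  have lam2: "1 \<le> lam\<^sup>2" using lam by simp
  have K_lam: "20 \<le> K * lam\<^sup>2" using mult_mono[of 20 K 1 "lam\<^sup>2"] K lam2 by simp
  show pos: "0 < \<theta>" using \<delta> K lam by (simp add: \<theta>_eq)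
  show small: "20 * \<theta> \<le> \<delta>"
    using K_lam \<delta> mult_left_mono[of 20 "K * lam\<^sup>2" \<delta>] by (simp add: \<theta>_eq field_simps)
  then show less: "\<theta> < 1" using pos \<delta> by linarith
  have "ln (1 / \<theta>) = ln (1 / \<delta>) + ln K + 2 * ln lam"
    using \<delta> K lam by (simp add: \<theta>_eq ln_div ln_mult ln_realpow)
  \<comment> \<open>Here \<open>ln (1 / \<delta>)\<close> equals \<open>lam - 1\<close> and
    \<open>ln lam\<close> is at most \<open>lam - 1\<close>, which gives the coefficient 3.\<close>
  also have "\<dots> \<le> 3 * lam + ln K * 1"
    using ln_le_minus_one[of lam] lam by (simp add: lam_def)
  also have "\<dots> \<le> 3 * lam + ln K * lam"
    using lam K by (intro add_left_mono mult_left_mono) auto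
  finally have ln_\<theta>: "ln (1 / \<theta>) \<le> (3 + ln K) * lam" by (simp add: algebra_simps)
  have "real (rbs_depth \<alpha> \<theta>) + 1 \<le> ln (1 / \<theta>) / a + lam"
    using rbs_depth_le[OF \<alpha> pos less] lam by (simp add: a_def)
  also have "\<dots> \<le> (3 + ln K) * lam / a + lam"
    using ln_\<theta> a by (intro add_right_mono divide_right_mono) auto
  also have "\<dots> = b * lam" by (simp add: b_def algebra_simps)
  finally have depth: "(real (rbs_depth \<alpha> \<theta>) + 1)\<^sup>2 \<le> (b * lam)\<^sup>2"
    by (intro power_mono) auto
  have "400 * (real (rbs_depth \<alpha> \<theta>) + 1)\<^sup>2 * \<alpha> * \<theta> \<le> 400 * (b * lam)\<^sup>2 * 1 * \<theta>"
    using depth pos \<alpha> by (intro mult_right_mono mult_mono) auto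
  also have "\<dots> = 400 * b\<^sup>2 * \<delta> / K"
    using lam K by (simp add: \<theta>_eq power_mult_distrib)
  also have "\<dots> \<le> \<delta> / 64"
  proof -
    have "25600 * b\<^sup>2 * \<delta> \<le> K * \<delta>"
      using K(2) \<delta> by (intro mult_right_mono) (auto simp: b_def a_def)
    then show ?thesis using K(1) by (simp add: field_simps)
  qed
  finally show "400 * (real (rbs_depth \<alpha> \<theta>) + 1)\<^sup>2 * \<alpha> * \<theta> \<le> \<delta> / 64" .
qed

text \<open>With k copies a node fails with probability at most \<open>exp (- k)\<close>, so the
  factor \<open>c + 1\<close> leaves \<open>n\<close> to the power \<open>- c\<close> after a union
  bound over \<open>n\<close> nodes. The added 1 guarantees a copy when \<open>ln n\<close> is
  0.\<close>

definition num_copies :: "real \<Rightarrow> nat \<Rightarrow> nat" where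
  "num_copies c n = nat \<lceil>(c + 1) * ln (real n)\<rceil> + 1"

lemma num_copies_pos: "0 < num_copies c n"
  by (simp add: num_copies_def)

lemma num_copies_le:
  assumes "1 \<le> n" "0 < c"
  shows "real (num_copies c n) \<le> (c + 1) * ln (real n) + 2"
proof -
  have "0 \<le> (c + 1) * ln (real n)" using assms by simp
  then show ?thesis unfolding num_copies_def by linarith
qed

lemma num_copies_bigo:
  assumes "0 < c"
  shows "(\<lambda>n. real (num_copies c n)) \<in> O(\<lambda>n. ln (real n))"
\<comment> \<open>Once \<open>ln n\<close> is at least 1 it absorbs the additive 2 of
  \<open>num_copies_le\<close>, hence \<open>c + 3\<close>.\<close>
proof (rule bigoI[where c = "c + 3"])
  have "eventually (\<lambda>n. 1 \<le> ln (real n)) sequentially" by real_asymp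
  then show "\<forall>\<^sub>F n in sequentially. norm (real (num_copies c n)) \<le> (c + 3) * norm (ln (real n))"
    using eventually_ge_at_top[of "1::nat"]
  proof eventually_elim
    case (elim n)
    then show ?case using num_copies_le[of n c] assms by (simp add: algebra_simps)
  qed
qed

lemma num_copies_failure:
  assumes "1 \<le> n" "0 < c"
  shows "real n * exp (- real (num_copies c n)) \<le> 1 / real n powr c"
proof -
  have "(c + 1) * ln (real n) \<le> real (num_copies c n)" unfolding num_copies_def by linarith
  then have "exp (- real (num_copies c n)) \<le> exp (- ((c + 1) * ln (real n)))" by simp
  also have "\<dots> = real n powr (- (c + 1))" using assms by (simp add: powr_def algebra_simps)
  finally have "real n * exp (- real (num_copies c n)) \<le> real n powr 1 * real n powr (- (c + 1))"
    using assms by (intro mult_mono) auto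
  also have "\<dots> = real n powr (- c)" unfolding powr_add[symmetric] by simp
  finally show ?thesis by (simp add: powr_minus_divide)
qed

theorem theorem4p1:
  fixes \<alpha> c :: real
  assumes "0 < \<alpha>" "\<alpha> < 1" "0 < c"
  shows "\<exists>(\<theta> :: nat \<Rightarrow> real \<Rightarrow> real) (k :: nat \<Rightarrow> nat) (C :: real) (p :: nat).
    0 < C \<and>
    (\<forall>n. 0 < k n) \<and> (\<lambda>n. real (k n)) \<in> O(\<lambda>n. ln (real n)) \<and>
    (\<forall>n \<delta>. 1 \<le> n \<and> 0 < \<delta> \<and> \<delta> < 1 \<longrightarrow>
       0 < \<theta> n \<delta> \<and> \<theta> n \<delta> < 1 \<and>
       \<delta> / (C * polylog p n \<delta>) \<le> \<theta> n \<delta> \<and> \<theta> n \<delta> \<le> C * polylog p n \<delta> * \<delta>) \<and>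
    (\<forall>(G :: 'a pair_pre_digraph) t \<delta> n M.
       pair_fin_digraph G \<and> t \<in> pverts G \<and> 0 < \<delta> \<and> \<delta> < 1 \<and>
       n = card (pverts G) \<and> M = rbs_space G \<alpha> (\<theta> n \<delta>) (k n) \<longrightarrow>
         measure M {\<omega> \<in> space M. \<forall>s\<in>pverts G. ppr G \<alpha> s t > \<delta> \<longrightarrow>
             \<bar>rbs_median G \<alpha> (\<theta> n \<delta>) (\<lambda>_. 1) (k n) t \<omega> s - ppr G \<alpha> s t\<bar>
               \<le> 1 / 10 * ppr G \<alpha> s t}
           \<ge> 1 - 1 / real n powr c \<and>
         (\<integral>\<^sup>+\<omega>. of_nat (rbs_total_cost G \<alpha> (\<theta> n \<delta>) (\<lambda>_. 1) (k n) t \<omega>) \<partial>M)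
           \<le> ennreal (C * polylog p n \<delta> * (real n * pagerank G \<alpha> t / \<delta>))) \<and>
    (\<forall>(G :: 'a pair_pre_digraph) \<delta> n M.
       pair_fin_digraph G \<and> pverts G \<noteq> {} \<and> 0 < \<delta> \<and> \<delta> < 1 \<and>
       n = card (pverts G) \<and> M = rbs_space G \<alpha> (\<theta> n \<delta>) (k n) \<longrightarrow>
         (\<integral>\<^sup>+t. (\<integral>\<^sup>+\<omega>. of_nat (rbs_total_cost G \<alpha> (\<theta> n \<delta>) (\<lambda>_. 1) (k n) t \<omega>) \<partial>M)
            \<partial>measure_pmf (pmf_of_set (pverts G)))
           \<le> ennreal (C * polylog p n \<delta> * (1 / \<delta>)))"
proof -
  obtain K where K: "20 \<le> K" "25600 * ((3 + ln K) / ln (1 / (1 - \<alpha>)) + 1)\<^sup>2 \<le> K"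
    using ex_accuracy_constant[of "ln (1 / (1 - \<alpha>))"] assms by auto
  define \<theta> :: "nat \<Rightarrow> real \<Rightarrow> real" where "\<theta> n \<delta> = \<delta> / (K * (1 + ln (1 / \<delta>))\<^sup>2)" for n \<delta>
  define k where "k = num_copies c"
  \<comment> \<open>The factor \<open>c + 3\<close> bounds the copies per logarithm,
    \<open>K\<close> comes from the inverse of \<theta>, and the inverse of \<alpha> from the charge
    per update.\<close>
  define C where "C = (c + 3) * K / \<alpha>"
  have C: "1 \<le> C" "K \<le> C"
  proof -
    have "K * \<alpha> \<le> K * (c + 3)" using assms K by (intro mult_left_mono) auto
    then show "K \<le> C" using assms by (simp add: C_def field_simps)
    then show "1 \<le> C" using K by linarith
  qed
  have \<theta>_bounds: "0 < \<theta> n \<delta>" "\<theta> n \<delta> < 1" "20 * \<theta> n \<delta> \<le> \<delta>"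
      "400 * (real (rbs_depth \<alpha> (\<theta> n \<delta>)) + 1)\<^sup>2 * \<alpha> * \<theta> n \<delta> \<le> \<delta> / 64"
    if "0 < \<delta>" "\<delta> < 1" for n \<delta>
    using accuracy_of_threshold[OF assms(1,2) that K] unfolding \<theta>_def by blast+
  \<comment> \<open>The exponent 3 collects two logarithms from \<theta> and one from the number of
    copies.\<close>
  have polylog: "1 + ln (1 / \<delta>) \<le> 1 + ln (real n) + ln (1 / \<delta>)" "1 \<le> 1 + ln (1 / \<delta>)"
      "(1 + ln (1 / \<delta>))\<^sup>2 \<le> polylog 3 n \<delta>" "1 \<le> polylog 3 n \<delta>"
      "(1 + ln (real n) + ln (1 / \<delta>)) * (1 + ln (1 / \<delta>))\<^sup>2 \<le> polylog 3 n \<delta>"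
    if "1 \<le> n" "0 < \<delta>" "\<delta> < 1" for n :: nat and \<delta>
  proof -
    let ?l = "1 + ln (1 / \<delta>)" and ?p = "1 + ln (real n) + ln (1 / \<delta>)"
    show l: "?l \<le> ?p" "1 \<le> ?l" using that by auto
    have sq: "?l\<^sup>2 \<le> ?p\<^sup>2" using l by (intro power_mono) auto
    have "?p * ?l\<^sup>2 \<le> ?p * ?p\<^sup>2" using sq l by (intro mult_left_mono) auto
    then show p: "?p * ?l\<^sup>2 \<le> polylog 3 n \<delta>"
      by (simp add: polylog_def power3_eq_cube power2_eq_square)
    have "1 * ?l\<^sup>2 \<le> ?p * ?l\<^sup>2" using l by (intro mult_right_mono) auto
    then show q: "?l\<^sup>2 \<le> polylog 3 n \<delta>" using p by linarith
    have "1 \<le> ?l\<^sup>2" using l(2) by simp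
    then show "1 \<le> polylog 3 n \<delta>" using q by linarith
  qed
  have \<theta>_polylog: "\<delta> / (C * polylog 3 n \<delta>) \<le> \<theta> n \<delta>" "\<theta> n \<delta> \<le> C * polylog 3 n \<delta> * \<delta>"
    if "1 \<le> n" "0 < \<delta>" "\<delta> < 1" for n \<delta>
  proof -
    have "K * (1 + ln (1 / \<delta>))\<^sup>2 \<le> C * polylog 3 n \<delta>"
      using C K polylog[OF that] by (intro mult_mono) auto
    moreover have "0 < K * (1 + ln (1 / \<delta>))\<^sup>2"
      using K(1) polylog(2)[OF that] by (intro mult_pos_pos zero_less_power) linarith+
    ultimately show "\<delta> / (C * polylog 3 n \<delta>) \<le> \<theta> n \<delta>"
      unfolding \<theta>_def using that by (intro divide_left_mono) auto
    have "1 * 1 \<le> C * polylog 3 n \<delta>"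
      using C polylog[OF that] by (intro mult_mono) auto
    then have "1 * \<delta> \<le> C * polylog 3 n \<delta> * \<delta>"
      using that by (intro mult_right_mono) auto
    then show "\<theta> n \<delta> \<le> C * polylog 3 n \<delta> * \<delta>"
      using \<theta>_bounds[OF that(2,3), of n] by linarith
  qed
  have cost_factor: "real (k n) / (\<alpha> * \<theta> n \<delta>) \<le> C * polylog 3 n \<delta> / \<delta>"
    if n: "1 \<le> n" and \<delta>: "0 < \<delta>" "\<delta> < 1" for n \<delta>
  proof -
    let ?l = "1 + ln (1 / \<delta>)" and ?p = "1 + ln (real n) + ln (1 / \<delta>)"
    note P = polylog[OF n \<delta>]
    have "real (k n) \<le> (c + 1) * ln (real n) + 2"
      unfolding k_def using n assms by (intro num_copies_le) auto
    also have "\<dots> \<le> (c + 1) * ?p + 2 * ?p"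
      using P assms \<delta> n by (intro add_mono mult_left_mono) auto
    finally have "real (k n) \<le> (c + 3) * ?p" by (simp add: algebra_simps)
    then have "real (k n) * (K * ?l\<^sup>2) \<le> (c + 3) * ?p * (K * ?l\<^sup>2)"
      using K by (intro mult_right_mono) auto
    also have "\<dots> = (c + 3) * K * (?p * ?l\<^sup>2)" by (simp only: mult_ac)
    also have "\<dots> \<le> (c + 3) * K * polylog 3 n \<delta>"
      using P K assms by (intro mult_left_mono) auto
    finally have "real (k n) * (K * ?l\<^sup>2) / (\<alpha> * \<delta>) \<le> (c + 3) * K * polylog 3 n \<delta> / (\<alpha> * \<delta>)"
      using assms \<delta> by (intro divide_right_mono) auto
    then show ?thesis by (simp add: \<theta>_def C_def)
  qed
  have cost: "(\<integral>\<^sup>+\<omega>. of_nat (rbs_total_cost G \<alpha> (\<theta> n \<delta>) (\<lambda>_. 1) (k n) t \<omega>) \<partial>rbs_space G \<alpha> (\<theta> n \<delta>) (k n))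
      \<le> ennreal (C * polylog 3 n \<delta> * (real n * pagerank G \<alpha> t / \<delta>))"
    if "pair_fin_digraph G" "t \<in> pverts G" "0 < \<delta>" "\<delta> < 1" "n = card (pverts G)"
    for G :: "'a pair_pre_digraph" and t \<delta> n
  proof -
    interpret rbs_copies G \<alpha> t "\<theta> n \<delta>" "k n"
      using that assms \<theta>_bounds
      by (intro rbs_copies.intro rbs_run.intro rbs_run_axioms.intro walk_graph.intro) auto
    have n: "1 \<le> n" using that finite_verts by (auto simp: Suc_le_eq card_gt_0_iff)
    have "real (k n) * (real n * pagerank G \<alpha> t) / (\<alpha> * \<theta> n \<delta>)
        = real (k n) / (\<alpha> * \<theta> n \<delta>) * (real n * pagerank G \<alpha> t)" by simp
    also have "\<dots> \<le> C * polylog 3 n \<delta> / \<delta> * (real n * pagerank G \<alpha> t)"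
      using cost_factor[OF n that(3,4)] by (intro mult_right_mono) (auto simp: pagerank_nonneg)
    also have "\<dots> = C * polylog 3 n \<delta> * (real n * pagerank G \<alpha> t / \<delta>)" by simp
    finally show ?thesis
      using expected_total_cost_le that(5) unfolding rbs_space_eq
      by (meson ennreal_leI order.trans)
  qed
  have accuracy: "measure M {\<omega> \<in> space M. \<forall>s\<in>pverts G. ppr G \<alpha> s t > \<delta> \<longrightarrow>
             \<bar>rbs_median G \<alpha> (\<theta> n \<delta>) (\<lambda>_. 1) (k n) t \<omega> s - ppr G \<alpha> s t\<bar>
               \<le> 1 / 10 * ppr G \<alpha> s t}
           \<ge> 1 - 1 / real n powr c"
    if "pair_fin_digraph G" "t \<in> pverts G" "0 < \<delta>" "\<delta> < 1" "n = card (pverts G)"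
      "M = rbs_space G \<alpha> (\<theta> n \<delta>) (k n)"
    for G :: "'a pair_pre_digraph" and t \<delta> n M
  proof -
    interpret R: rbs_copies G \<alpha> t "\<theta> n \<delta>" "k n"
      using that assms \<theta>_bounds
      by (intro rbs_copies.intro rbs_run.intro rbs_run_axioms.intro walk_graph.intro) auto
    have n: "1 \<le> n" using that R.finite_verts by (auto simp: Suc_le_eq card_gt_0_iff)
    have "1 - 1 / real n powr c \<le> 1 - real n * exp (- real (k n))"
      using num_copies_failure[OF n assms(3)] by (simp add: k_def)
    also have "\<dots> \<le> measure M {\<omega> \<in> space M. \<forall>s\<in>pverts G. ppr G \<alpha> s t > \<delta> \<longrightarrow>
             \<bar>rbs_median G \<alpha> (\<theta> n \<delta>) (\<lambda>_. 1) (k n) t \<omega> s - ppr G \<alpha> s t\<bar>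
               \<le> 1 / 10 * ppr G \<alpha> s t}"
      using R.prob_all_medians_close[of \<delta>] \<theta>_bounds[OF that(3,4), of n] num_copies_pos[of c n]
      unfolding that(6) R.rbs_space_eq by (simp only: k_def that(5))
    finally show ?thesis .
  qed
  have average: "(\<integral>\<^sup>+t. (\<integral>\<^sup>+\<omega>. of_nat (rbs_total_cost G \<alpha> (\<theta> n \<delta>) (\<lambda>_. 1) (k n) t \<omega>)
            \<partial>rbs_space G \<alpha> (\<theta> n \<delta>) (k n)) \<partial>measure_pmf (pmf_of_set (pverts G)))
           \<le> ennreal (C * polylog 3 n \<delta> * (1 / \<delta>))"
    if "pair_fin_digraph G" "pverts G \<noteq> {}" "0 < \<delta>" "\<delta> < 1" "n = card (pverts G)"
    for G :: "'a pair_pre_digraph" and \<delta> n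
  proof -
    have fin: "finite (pverts G)"
      using that(1) by (auto simp: pair_fin_digraph_def pair_fin_digraph_axioms_def)
    have n: "1 \<le> n" using that fin by (auto simp: Suc_le_eq card_gt_0_iff)
    have F: "0 \<le> C * polylog 3 n \<delta> / \<delta>" using C polylog[OF n that(3,4)] that by auto
    let ?h = "\<lambda>t. C * polylog 3 n \<delta> * (real n * pagerank G \<alpha> t / \<delta>)"
    have "(\<integral>\<^sup>+t. (\<integral>\<^sup>+\<omega>. of_nat (rbs_total_cost G \<alpha> (\<theta> n \<delta>) (\<lambda>_. 1) (k n) t \<omega>)
            \<partial>rbs_space G \<alpha> (\<theta> n \<delta>) (k n)) \<partial>measure_pmf (pmf_of_set (pverts G)))
        \<le> (\<integral>\<^sup>+t. ennreal (?h t) \<partial>measure_pmf (pmf_of_set (pverts G)))"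
      \<comment> \<open>The cost bound requires a target in the graph, and the uniform distribution
        gives mass to such targets only.\<close>
      using that fin cost by (intro nn_integral_mono_AE) (simp add: AE_measure_pmf_iff)
    also have "\<dots> = ennreal (\<integral>t. ?h t \<partial>measure_pmf (pmf_of_set (pverts G)))"
      using that fin C polylog[OF n that(3,4)]
      by (intro nn_integral_eq_integral integrable_measure_pmf_finite)
         (auto simp: pagerank_nonneg)
    \<comment> \<open>Averaging over \<open>n\<close> targets cancels the factor \<open>n\<close>
      and leaves the sum of all PageRank values, which is at most 1.\<close>
    also have "(\<integral>t. ?h t \<partial>measure_pmf (pmf_of_set (pverts G)))
        = C * polylog 3 n \<delta> / \<delta> * (\<Sum>t\<in>pverts G. pagerank G \<alpha> t)"
      using that fin n by (simp add: integral_pmf_of_set sum_distrib_left sum_divide_distrib)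
    also have "\<dots> \<le> C * polylog 3 n \<delta> / \<delta> * 1"
      using that assms F by (intro mult_left_mono sum_pagerank_le_1)
    finally show ?thesis by (simp add: ennreal_leI)
  qed
  show ?thesis
  proof (rule exI[of _ \<theta>], rule exI[of _ k], rule exI[of _ C], rule exI[of _ 3],
      intro conjI allI impI, goal_cases)
    case 1
    show ?case using C by linarith
  next
    case 2
    show ?case by (simp add: k_def num_copies_pos)
  next
    case 3
    show ?case unfolding k_def by (rule num_copies_bigo[OF assms(3)])
  next
    case (4 n \<delta>)
    then show ?case by (elim conjE) (rule \<theta>_bounds)
  next
    case (5 n \<delta>)
    then show ?case by (elim conjE) (rule \<theta>_bounds)
  next
    case (6 n \<delta>)
    then show ?case by (elim conjE) (rule \<theta>_polylog)
  next
    case (7 n \<delta>)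
    then show ?case by (elim conjE) (rule \<theta>_polylog)
  next
    case (8 G t \<delta> n M)
    then show ?case by (elim conjE) (rule accuracy)
  next
    case (9 G t \<delta> n M)
    then show ?case by (elim conjE) (simp only:, rule cost, simp_all only:)
  next
    case (10 G \<delta> n M)
    then show ?case by (elim conjE) (simp only:, rule average, simp_all only: not_False_eq_True)
  qed
qed

end
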